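(* Let $R_{\alpha,\gamma,\gamma'}^{t(\alpha)}$ be an annulus obtained by isometrically gluing two nonstandard half-collars $R_{\alpha,\gamma}$ and $R_{\alpha',\gamma'}$ along their boundary geodesics $\alpha$ and $\alpha'$ of equal length with twist $-\frac12\le t(\alpha)<\frac12$. Given $\ell_0\ge2$, there exists $C>0$ such that for all such annuli with $\ell(\alpha)\ge\ell_0$ we have $$\lambda\big(R_{\alpha,\gamma,\gamma'}^{t(\alpha)}\big)\ge\frac{C}{\max\left\{e^{r(\ell(\eta))-|t(\alpha)|\frac{\ell(\alpha)}2},\;e^{r(\ell(\eta'))-|t(\alpha)|\frac{\ell(\alpha)}2}\right\}},$$ where $r(x)=\sinh^{-1}\!\left(\frac1{\sinh x}\right)$.
   Context: A geodesic pair of pants $P$ is a complete hyperbolic (curvature $-1$) surface homeomorphic to a sphere minus three disks whose boundary components are closed geodesics or punctures, at least one being a closed geodesic. Let $\alpha$ be a boundary geodesic of $P$ and $\alpha_1,\alpha_2$ the other two boundary components (geodesics or punctures). Let $\gamma$ be the simple orthogeodesic in $P$ from $\alpha$ to $\alpha_1$. If $\alpha_1$ is a geodesic, let $b$ be the endpoint of $\gamma$ on $\alpha_1$; in each of the two hexagons into which the simple orthogeodesics cut $P$, drop the perpendicular from $b$ to the simple orthogeodesic from $\alpha$ to $\alpha_2$. The union of the two perpendiculars is a piecewise geodesic loop $\beta$ with corner $b$. If $\alpha_1$ is a puncture, $\gamma$ is the simple geodesic ray from $\alpha$ orthogonal to $\alpha$ going out the puncture, $\ell(\gamma)=\infty$,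 and $\beta$ is the simple bi-infinite geodesic going out the puncture $\alpha_1$ in both directions and orthogonal to the simple orthogeodesic from $\alpha$ to $\alpha_2$. The nonstandard half-collar $R_{\alpha,\gamma}$ is the annular region of $P$ between $\alpha$ and $\beta$. The segment $\eta$ is the part, between $\alpha$ and $\beta$, of the orthogeodesic from $\alpha$ to $\alpha_2$; equivalently $\tanh\ell(\eta)=\tanh\ell(\gamma)/\cosh(\ell(\alpha)/2)$ (with $\tanh\infty=1$). The objects $\alpha',\gamma',\eta'$ are the analogous objects in a second pair of pants $P'$. Gluing with twist $t(\alpha)$: the geodesics $\alpha$ and $\alpha'$ (of equal length) are identified by an isometry, with the two half-collars on opposite sides, such that the shorter arc of $\alpha\equiv\alpha'$ between the foot of $\gamma$ and the foot of $\gamma'$ has length $|t(\alpha)|\ell(\alpha)$ (the sign of $t(\alpha)$ records direction). For a doubly connected region $R$, $\lambda(R)$ is the extremal length of the family of curves in $R$ connecting its two boundary components. *)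

theory Defs
  imports "HOL-Analysis.Analysis"
begin

text \<open>
  Surfaces are handled through their universal covers, inside the upper half-plane.  A complete
  hyperbolic surface with geodesic boundary is a quotient of a closed convex subset of the
  hyperbolic plane, bounded by complete geodesics, by a discrete group of orientation-preserving
  isometries acting freely.
\<close>

section \<open>The hyperbolic plane\<close>

definition uhp :: "complex set" where
  "uhp = {z. Im z > 0}"

definition hdist :: "complex \<Rightarrow> complex \<Rightarrow> real" where
  "hdist z w = arcosh (1 + (cmod (z - w))\<^sup>2 / (2 * Im z * Im w))"

definition hsegment :: "complex \<Rightarrow> complex \<Rightarrow> complex set" where
  "hsegment z w = {p \<in> uhp. hdist z p + hdist p w = hdist z w}"

definition SL2R :: "(real^2^2) set" where
  "SL2R = {M. det M = 1}"

definition moeb :: "real^2^2 \<Rightarrow> complex \<Rightarrow> complex" where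
  "moeb M z = (of_real (M$1$1) * z + of_real (M$1$2)) / (of_real (M$2$1) * z + of_real (M$2$2))"

text \<open>
  The matrix \<open>M\<close> maps the ideal point \<open>u\<close> to the ideal point \<open>v\<close> (both different from \<open>\<infinity>\<close>).
  If the denominator of the action vanished at \<open>u\<close>, then so would the numerator, which is
  impossible for an invertible matrix.
\<close>
definition moves_ideal :: "real^2^2 \<Rightarrow> real \<Rightarrow> real \<Rightarrow> bool" where
  "moves_ideal M u v \<longleftrightarrow> M$1$1 * u + M$1$2 = v * (M$2$1 * u + M$2$2)"

definition nontrivial :: "real^2^2 \<Rightarrow> bool" where
  "nontrivial M \<longleftrightarrow> M \<noteq> mat 1 \<and> M \<noteq> - mat 1"

definition imag_axis :: "complex set" where
  "imag_axis = {z \<in> uhp. Re z = 0}"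

definition unit_semicircle :: "complex set" where
  "unit_semicircle = {z \<in> uhp. cmod z = 1}"

definition geodesic_line :: "complex set \<Rightarrow> bool" where
  "geodesic_line A \<longleftrightarrow> (\<exists>M\<in>SL2R. A = moeb M ` imag_axis)"

text \<open>
  Orientation-preserving isometries are conformal and act transitively on the pairs of complete
  geodesics meeting at a right angle; one such pair is the imaginary axis and the unit semicircle.
\<close>
definition orthogonal_lines :: "complex set \<Rightarrow> complex set \<Rightarrow> bool" where
  "orthogonal_lines A B \<longleftrightarrow>
     (\<exists>M\<in>SL2R. A = moeb M ` imag_axis \<and> B = moeb M ` unit_semicircle)"

definition perp_foot :: "complex \<Rightarrow> complex set \<Rightarrow> complex \<Rightarrow> bool" where
  "perp_foot z D f \<longleftrightarrow> (\<exists>B. orthogonal_lines B D \<and> z \<in> B \<and> f \<in> B \<inter> D)"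


section \<open>Geodesic pairs of pants\<close>

definition fuchsian :: "(real^2^2) set \<Rightarrow> bool" where
  "fuchsian G \<longleftrightarrow> G \<subseteq> SL2R \<and> mat 1 \<in> G \<and>
     (\<forall>M\<in>G. \<forall>M'\<in>G. M ** M' \<in> G) \<and> (\<forall>M\<in>G. matrix_inv M \<in> G) \<and>
     (\<forall>K. compact K \<and> K \<subseteq> uhp \<longrightarrow> finite {M \<in> G. moeb M ` K \<inter> K \<noteq> {}}) \<and>
     (\<forall>M\<in>G. \<forall>z\<in>uhp. moeb M z = z \<longrightarrow> \<not> nontrivial M)"

text \<open>
  \<open>N\<close> modulo \<open>G\<close> is a complete hyperbolic surface with geodesic boundary.
\<close>
definition hyperbolic_surface :: "(real^2^2) set \<Rightarrow> complex set \<Rightarrow> bool" where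
  "hyperbolic_surface G N \<longleftrightarrow> fuchsian G \<and>
     closedin (top_of_set uhp) N \<and> interior N \<noteq> {} \<and>
     (\<forall>z\<in>N. \<forall>w\<in>N. hsegment z w \<subseteq> N) \<and>
     (\<forall>M\<in>G. moeb M ` N = N) \<and>
     (\<forall>z\<in>frontier N \<inter> uhp. \<exists>A. geodesic_line A \<and> z \<in> A \<and> A \<subseteq> frontier N)"

text \<open>
  The interior of the surface is homeomorphic to a sphere minus three disks.  A sphere minus three
  disjoint closed disks is homeomorphic to a sphere minus three points, here \<open>0\<close>, \<open>1\<close>, \<open>\<infinity>\<close>; the
  quotient is expressed by a quotient map whose fibres are the orbits.  Looking only at the
  interior treats boundary geodesics and punctures alike.
\<close>
definition three_holed_sphere :: "(real^2^2) set \<Rightarrow> complex set \<Rightarrow> bool" where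
  "three_holed_sphere G N \<longleftrightarrow>
     (\<exists>p :: complex \<Rightarrow> complex.
        quotient_map (top_of_set (interior N)) (top_of_set (- {0, 1})) p \<and>
        (\<forall>z\<in>interior N. \<forall>w\<in>interior N. p z = p w \<longleftrightarrow> (\<exists>M\<in>G. w = moeb M z)))"

text \<open>
  Lifts of boundary components: a geodesic in the frontier of \<open>N\<close>, closed in the quotient because
  it is stabilised by a nontrivial element, or the fixed point of a parabolic element.
\<close>
datatype boundary = Geodesic "complex set" | Puncture real

fun is_boundary :: "(real^2^2) set \<Rightarrow> complex set \<Rightarrow> boundary \<Rightarrow> bool" where
  "is_boundary G N (Geodesic A) \<longleftrightarrow>
     geodesic_line A \<and> A \<subseteq> frontier N \<and> (\<exists>M\<in>G. nontrivial M \<and> moeb M ` A = A)"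
| "is_boundary G N (Puncture u) \<longleftrightarrow>
     of_real u \<in> closure N \<and>
     (\<exists>M\<in>G. nontrivial M \<and> \<bar>trace M\<bar> = 2 \<and> moves_ideal M u u)"

fun same_boundary :: "(real^2^2) set \<Rightarrow> boundary \<Rightarrow> boundary \<Rightarrow> bool" where
  "same_boundary G (Geodesic A) (Geodesic B) \<longleftrightarrow> (\<exists>M\<in>G. moeb M ` A = B)"
| "same_boundary G (Puncture u) (Puncture v) \<longleftrightarrow> (\<exists>M\<in>G. moves_ideal M u v)"
| "same_boundary G _ _ \<longleftrightarrow> False"

text \<open>
  A three-holed sphere has exactly three ends, so three inequivalent boundary components exhaust
  the ends: there is no further boundary geodesic, cusp or funnel.
\<close>
definition geodesic_pants ::
  "(real^2^2) set \<Rightarrow> complex set \<Rightarrow> boundary \<Rightarrow> boundary \<Rightarrow> boundary \<Rightarrow> bool" where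
  "geodesic_pants G N e e1 e2 \<longleftrightarrow>
     hyperbolic_surface G N \<and> three_holed_sphere G N \<and>
     is_boundary G N e \<and> is_boundary G N e1 \<and> is_boundary G N e2 \<and>
     \<not> same_boundary G e e1 \<and> \<not> same_boundary G e e2 \<and> \<not> same_boundary G e1 e2"

text \<open>
  The imaginary axis covers a closed geodesic of length \<open>l\<close>: the elements of \<open>G\<close> that translate
  along it are those translating by the multiples of \<open>l\<close>.
\<close>
definition axis_length :: "(real^2^2) set \<Rightarrow> real \<Rightarrow> bool" where
  "axis_length G l \<longleftrightarrow> l > 0 \<and>
     {s. \<exists>M\<in>G. \<forall>z\<in>uhp. moeb M z = of_real (exp s) * z} = range (\<lambda>k::int. of_int k * l)"

text \<open>
  A simple orthogeodesic from the boundary geodesic covered by the imaginary axis to the boundary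
  component covered by \<open>e\<close>, given by the complete geodesic \<open>D\<close> carrying a lift of it.  The lift
  itself is \<open>D \<inter> N\<close>: a segment, or a ray if \<open>e\<close> is a puncture.
\<close>
definition simple_orthogeodesic ::
  "(real^2^2) set \<Rightarrow> complex set \<Rightarrow> boundary \<Rightarrow> complex set \<Rightarrow> bool" where
  "simple_orthogeodesic G N e D \<longleftrightarrow>
     orthogonal_lines imag_axis D \<and>
     (case e of Geodesic A \<Rightarrow> orthogonal_lines A D | Puncture u \<Rightarrow> of_real u \<in> closure D) \<and>
     (\<forall>M\<in>G. nontrivial M \<longrightarrow> moeb M ` (D \<inter> N) \<inter> (D \<inter> N) = {})"


section \<open>Nonstandard half-collars\<close>

text \<open>
  A pair of pants with its boundary geodesic \<open>\<alpha>\<close>, covered by the imaginary axis, and lifts \<open>comp1\<close>,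
  \<open>comp2\<close> of \<open>\<alpha>\<^sub>1\<close>, \<open>\<alpha>\<^sub>2\<close>; geodesics \<open>perp1\<close>, \<open>perp2\<close> carrying lifts of the simple orthogeodesics from
  \<open>\<alpha>\<close> to \<open>\<alpha>\<^sub>1\<close> (this is \<open>\<gamma>\<close>) and to \<open>\<alpha>\<^sub>2\<close>, and their feet on the imaginary axis; a lift \<open>loop\<close> of \<open>\<beta>\<close>
  (one period), and the point \<open>cross\<close> where it meets \<open>perp2\<close>.
\<close>
record half_collar_data =
  deck :: "(real^2^2) set"
  cover :: "complex set"
  comp1 :: boundary
  comp2 :: boundary
  perp1 :: "complex set"
  perp2 :: "complex set"
  foot1 :: complex
  foot2 :: complex
  loop :: "complex set"
  cross :: complex

text \<open>
  The deck transformation along \<open>\<alpha>\<close> is multiplication by \<open>exp l\<close>.  The orthogeodesics to \<open>\<alpha>\<^sub>1\<close> cut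
  the axis at \<open>foot1\<close> and \<open>exp l * foot1\<close>; that \<open>foot2\<close> lies between means that the two hexagons of
  the pair of pants are developed side by side, on the two sides of \<open>perp2\<close>.  In each of
  them a perpendicular is dropped to \<open>perp2\<close> from the end of \<open>\<gamma>\<close>, namely from \<open>b\<close> in one
  hexagon and from \<open>exp l * b\<close>, the next lift of the same point, in the other one.  These two
  perpendiculars fit together to a loop, so they have the same foot.  If \<open>\<alpha>\<^sub>1\<close> is a puncture,
  they form a complete geodesic joining two successive lifts of the puncture.
\<close>
definition half_collar :: "real \<Rightarrow> half_collar_data \<Rightarrow> bool" where
  "half_collar l X \<longleftrightarrow>
     geodesic_pants (deck X) (cover X) (Geodesic imag_axis) (comp1 X) (comp2 X) \<and>
     axis_length (deck X) l \<and>
     simple_orthogeodesic (deck X) (cover X) (comp1 X) (perp1 X) \<and>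
     simple_orthogeodesic (deck X) (cover X) (comp2 X) (perp2 X) \<and>
     foot1 X \<in> imag_axis \<inter> perp1 X \<and> foot2 X \<in> imag_axis \<inter> perp2 X \<and>
     Im (foot1 X) < Im (foot2 X) \<and> Im (foot2 X) < exp l * Im (foot1 X) \<and>
     cross X \<in> perp2 X \<inter> cover X \<and>
     (case comp1 X of
        Geodesic A \<Rightarrow>
          (\<exists>b \<in> perp1 X \<inter> A.
             perp_foot b (perp2 X) (cross X) \<and>
             perp_foot (of_real (exp l) * b) (perp2 X) (cross X) \<and>
             loop X = hsegment b (cross X) \<union> hsegment (cross X) (of_real (exp l) * b))
      | Puncture u \<Rightarrow>
          orthogonal_lines (loop X) (perp2 X) \<and> cross X \<in> loop X \<and>
          of_real u \<in> closure (loop X) \<and> of_real (exp l * u) \<in> closure (loop X))"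

definition eta_length :: "half_collar_data \<Rightarrow> real" where
  "eta_length X = hdist (foot2 X) (cross X)"

text \<open>
  The lift of \<open>\<beta>\<close> and the region between it and the imaginary axis (the latter included,
  the former not).  Dividing by multiplication by \<open>exp l\<close> gives the half-collar.
\<close>
definition beta_lift :: "real \<Rightarrow> half_collar_data \<Rightarrow> complex set" where
  "beta_lift l X = (\<Union>k::int. (\<lambda>z. of_real (exp (of_int k * l)) * z) ` loop X)"

definition half_collar_lift :: "real \<Rightarrow> half_collar_data \<Rightarrow> complex set" where
  "half_collar_lift l X =
     cover X \<inter> connected_component_set (uhp - beta_lift l X) (foot1 X)"


section \<open>Gluing\<close>

text \<open>
  Two half-collars developed on opposite sides of the imaginary axis, along which they are glued,
  with feet at signed distance \<open>t * l\<close>.  For \<open>-1/2 \<le> t < 1/2\<close> the arc between these two lifts of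
  the feet projects to a shortest arc between the feet on the closed geodesic.
\<close>
definition glued :: "real \<Rightarrow> real \<Rightarrow> half_collar_data \<Rightarrow> half_collar_data \<Rightarrow> bool" where
  "glued l t X X' \<longleftrightarrow> half_collar l X \<and> half_collar l X' \<and>
     cover X \<subseteq> {z. Re z \<ge> 0} \<and> cover X' \<subseteq> {z. Re z \<le> 0} \<and>
     Im (foot1 X') = exp (t * l) * Im (foot1 X)"

definition glued_lift :: "real \<Rightarrow> half_collar_data \<Rightarrow> half_collar_data \<Rightarrow> complex set" where
  "glued_lift l X X' = half_collar_lift l X \<union> half_collar_lift l X'"


section \<open>Extremal length\<close>

text \<open>
  The curves are curves in an annulus \<open>R / (z \<mapsto> exp l * z)\<close>, with \<open>R\<close>
  contained in the upper half-plane, represented by their lifts; \<open>E\<close> and \<open>F\<close> are the preimages of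
  the two boundary components.
\<close>
definition connecting_curves ::
  "complex set \<Rightarrow> complex set \<Rightarrow> complex set \<Rightarrow> (real \<Rightarrow> complex) set" where
  "connecting_curves R E F =
     {c. c piecewise_C1_differentiable_on {0..1} \<and> c 0 \<in> E \<and> c 1 \<in> F \<and> c ` {0<..<1} \<subseteq> R}"

text \<open>
  Conformal metrics \<open>\<rho> |dz|\<close> on the quotient, i.e. metrics invariant under multiplication by \<open>exp l\<close>.
\<close>
definition quotient_metric :: "real \<Rightarrow> (complex \<Rightarrow> ennreal) \<Rightarrow> bool" where
  "quotient_metric l \<rho> \<longleftrightarrow> \<rho> \<in> borel_measurable borel \<and>
     (\<forall>z\<in>uhp. ennreal (exp l) * \<rho> (of_real (exp l) * z) = \<rho> z)"

definition metric_length :: "(complex \<Rightarrow> ennreal) \<Rightarrow> (real \<Rightarrow> complex) \<Rightarrow> ennreal" where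
  "metric_length \<rho> c =
     (\<integral>\<^sup>+ t\<in>{0..1}. \<rho> (c t) * ennreal (norm (vector_derivative c (at t))) \<partial>lborel)"

text \<open>
  The half-annulus \<open>1 \<le> |z| < exp l\<close> is a fundamental domain for multiplication by \<open>exp l\<close>.
\<close>
definition metric_area :: "real \<Rightarrow> complex set \<Rightarrow> (complex \<Rightarrow> ennreal) \<Rightarrow> ennreal" where
  "metric_area l R \<rho> = (\<integral>\<^sup>+ z\<in>(R \<inter> {z. 1 \<le> cmod z \<and> cmod z < exp l}). (\<rho> z)\<^sup>2 \<partial>lborel)"

definition annulus_extremal_length ::
  "real \<Rightarrow> complex set \<Rightarrow> complex set \<Rightarrow> complex set \<Rightarrow> ennreal" where
  "annulus_extremal_length l R E F =
     (SUP \<rho>\<in>{\<rho>. quotient_metric l \<rho> \<and> metric_area l R \<rho> \<noteq> 0 \<and> metric_area l R \<rho> \<noteq> \<infinity>}.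
        (INF c\<in>connecting_curves R E F. metric_length \<rho> c)\<^sup>2 / metric_area l R \<rho>)"

definition r_fun :: "real \<Rightarrow> real" where
  "r_fun x = arsinh (1 / sinh x)"

end

theory Submission
  imports Defs
begin

text \<open>
  In the coordinate \<open>log z = s + \<i>\<theta>\<close> the geodesic \<open>\<alpha>\<close> becomes the line \<open>\<theta> = \<pi>/2\<close>, and the deck transformation
  along it becomes the translation of \<open>s\<close> by \<open>l\<close>.  The lift of \<open>\<beta>\<close> is the periodic curve
  \<open>cos \<theta> = k cosh (dist (s - a, l\<int>))\<close>, where \<open>k = tanh \<ell>(\<eta>)\<close> and \<open>a\<close> is the coordinate of the foot of \<open>\<eta>\<close>, half a
  period after the foot of \<open>\<gamma>\<close> (lemmas \<open>loop_eq_perp_arc_part\<close> and \<open>beta_lift_eq_periodic_graph\<close>).  Thus the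
  half-collar is a periodic strip whose width at \<open>s\<close> is comparable to \<open>f(s) = k cosh (dist (s - a, l\<int>))\<close>.
  On the other side of \<open>\<alpha>\<close> lies a strip of width comparable to a function \<open>f'\<close> of the same kind, with its own
  \<open>k'\<close> and with \<open>a' = a + t l\<close>.

  Extremal length is bounded below by testing with one metric, \<open>|dz| / (|z| F(ln |z|))\<close> with \<open>F = f + f'\<close>.
  The logarithms of \<open>f\<close> and \<open>f'\<close> are Lipschitz with constant 1.  So a short curve from one boundary component
  to the other hardly changes \<open>s\<close>; it has to traverse an angle comparable to \<open>F(s)\<close>, and its length is at least
  1/8 (lemma \<open>width_metric_length_ge\<close>).  The area is at most a constant times the integral of \<open>1/F\<close> over one period
  (lemma \<open>width_metric_area_le\<close>).

  The twist enters through this integral.  The function \<open>F\<close> is at least \<open>min k k' / 2\<close> times the exponential of the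
  larger one of the distances from \<open>s\<close> to the lattices \<open>a + l\<int>\<close> and \<open>a' + l\<int>\<close>.  These lattices are shifted by \<open>t l\<close>
  with \<open>|t| \<le> 1/2\<close>, so the larger distance is at least \<open>|t| l / 2\<close> plus the distance from \<open>s\<close> to a lattice of
  spacing \<open>l/2\<close> (lemma \<open>two_lattices_dist\<close>).  Hence the area is at most a constant times
  \<open>exp (- |t| l / 2) / min k k'\<close>.  Finally \<open>1/k = cosh r(\<ell>(\<eta>)) \<le> exp r(\<ell>(\<eta>))\<close> (lemma \<open>exp_r_fun_ge\<close>), and similarly for \<open>k'\<close>, which turns the
  bound into the stated one.
\<close>

section \<open>Moebius transformations and orthogonal geodesics\<close>

lemma fractional_linear_denominator_nonzero: fixes a b c d :: real assumes "a*d - b*c = 1" "Im z > 0"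
  shows "of_real c * z + of_real d \<noteq> 0"
proof
  assume h: "of_real c * z + of_real d = 0"
  then have "Im (of_real c * z + of_real d) = 0" by simp
  then have "c = 0" using assms by simp
  with h have "d = 0" by simp
  with \<open>c = 0\<close> assms show False by simp
qed

lemma Im_fractional_linear: fixes a b c d :: real assumes "a*d - b*c = 1" "Im z > 0"
  shows "Im ((of_real a * z + of_real b) / (of_real c * z + of_real d))
    = Im z / (cmod (of_real c * z + of_real d))\<^sup>2"
proof -
  have "(a * Im z) * (c * Re z + d) - (a * Re z + b) * (c * Im z) = (a*d - b*c) * Im z"
    by (simp add: algebra_simps)
  then show ?thesis using assms
    by (simp add: Im_divide cmod_power2)
qed

lemma fractional_linear_diff: fixes a b c d :: real assumes "a*d - b*c = 1" "Im z > 0" "Im w > 0"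
  shows "(of_real a * z + of_real b) / (of_real c * z + of_real d) - (of_real a * w + of_real b) / (of_real c * w + of_real d)
    = (z - w) / ((of_real c * z + of_real d) * (of_real c * w + of_real d))"
proof -
  note n = fractional_linear_denominator_nonzero[OF assms(1,2)] fractional_linear_denominator_nonzero[OF assms(1,3)]
  have "(of_real a * z + of_real b) * (of_real c * w + of_real d) - (of_real a * w + of_real b) * (of_real c * z + of_real d)
     = of_real (a*d - b*c) * (z - w)"
    by (simp add: algebra_simps)
  then show ?thesis using assms(1) n by (simp add: diff_frac_eq)
qed

lemma SL2R_det: "M \<in> SL2R \<Longrightarrow> M$1$1 * M$2$2 - M$1$2 * M$2$1 = 1"
  by (simp add: SL2R_def det_2)

lemma moeb_in_uhp: assumes "M \<in> SL2R" "z \<in> uhp" shows "moeb M z \<in> uhp"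
  using Im_fractional_linear[OF SL2R_det[OF assms(1)], of z] fractional_linear_denominator_nonzero[OF SL2R_det[OF assms(1)], of z] assms
  by (simp add: uhp_def moeb_def)

lemma hdist_moeb:
  assumes M: "M \<in> SL2R" and z: "z \<in> uhp" and w: "w \<in> uhp"
  shows "hdist (moeb M z) (moeb M w) = hdist z w"
proof -
  note dt = SL2R_det[OF M]
  have zi: "Im z > 0" "Im w > 0" using z w by (auto simp: uhp_def)
  define p q where "p = cmod (of_real (M$2$1) * z + of_real (M$2$2))"
    and "q = cmod (of_real (M$2$1) * w + of_real (M$2$2))"
  have pq: "p > 0" "q > 0" using fractional_linear_denominator_nonzero[OF dt zi(1)] fractional_linear_denominator_nonzero[OF dt zi(2)] by (auto simp: p_def q_def)
  have "cmod (moeb M z - moeb M w) = cmod (z - w) / (p * q)"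
    using fractional_linear_diff[OF dt zi] by (simp add: moeb_def p_def q_def norm_divide norm_mult)
  moreover have "Im (moeb M z) = Im z / p\<^sup>2" "Im (moeb M w) = Im w / q\<^sup>2"
    using Im_fractional_linear[OF dt zi(1)] Im_fractional_linear[OF dt zi(2)] by (simp_all add: moeb_def p_def q_def)
  ultimately have "(cmod (moeb M z - moeb M w))\<^sup>2 / (2 * Im (moeb M z) * Im (moeb M w))
     = (cmod (z - w))\<^sup>2 / (2 * Im z * Im w)"
    using pq zi by (simp add: power_divide power_mult_distrib)
  then show ?thesis by (simp add: hdist_def)
qed

text \<open>
  Images are computed by pulling a condition back along the inverse matrix; the upper half-plane
  itself is preserved.
\<close>
lemma moeb_image_eq:
  assumes M: "M \<in> SL2R"
  shows "moeb M ` {z \<in> uhp. P z} =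
    {w \<in> uhp. P ((of_real (M$2$2) * w - of_real (M$1$2)) / (of_real (M$1$1) - of_real (M$2$1) * w))}"
proof -
  define a b c d where "a = M$1$1" and "b = M$1$2" and "c = M$2$1" and "d = M$2$2"
  have dt: "a*d - b*c = 1" and dt': "d * a - (-b) * (-c) = 1" using SL2R_det[OF M] by (simp_all add: a_def b_def c_def d_def mult.commute)
  have dtc: "of_real a * of_real d - of_real b * of_real c = (1::complex)"
    using dt by (metis of_real_1 of_real_diff of_real_mult)
  have mo: "moeb M z = (of_real a * z + of_real b) / (of_real c * z + of_real d)" for z
    by (simp add: moeb_def a_def b_def c_def d_def)
  have 1: "(of_real d * moeb M z - of_real b) / (of_real a - of_real c * moeb M z) = z" if "z \<in> uhp" for z
  proof -
    have n: "of_real c * z + of_real d \<noteq> 0" using fractional_linear_denominator_nonzero[OF dt, of z] that by (simp add: uhp_def)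
    have "of_real d * moeb M z - of_real b = (of_real a * of_real d - of_real b * of_real c) * z / (of_real c * z + of_real d)"
      using n by (simp add: mo field_simps)
    moreover have "of_real a - of_real c * moeb M z = (of_real a * of_real d - of_real b * of_real c) / (of_real c * z + of_real d)"
      using n by (simp add: mo field_simps)
    ultimately show ?thesis using n dtc by simp
  qed
  have 2: "moeb M ((of_real d * w - of_real b) / (of_real a - of_real c * w)) = w"
    and 3: "(of_real d * w - of_real b) / (of_real a - of_real c * w) \<in> uhp" if "w \<in> uhp" for w
  proof -
    have n: "of_real a - of_real c * w \<noteq> 0" using fractional_linear_denominator_nonzero[OF dt', of w] that by (simp add: uhp_def)
    define z where "z = (of_real d * w - of_real b) / (of_real a - of_real c * w)"
    have "of_real a * z + of_real b = (of_real a * of_real d - of_real b * of_real c) * w / (of_real a - of_real c * w)"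
      using n by (simp add: z_def field_simps)
    moreover have "of_real c * z + of_real d = (of_real a * of_real d - of_real b * of_real c) / (of_real a - of_real c * w)"
      using n by (simp add: z_def field_simps)
    ultimately show "moeb M ((of_real d * w - of_real b) / (of_real a - of_real c * w)) = w"
      using n dtc by (simp add: mo flip: z_def)
    show "(of_real d * w - of_real b) / (of_real a - of_real c * w) \<in> uhp"
      using Im_fractional_linear[OF dt', of w] that n by (simp add: uhp_def)
  qed
  show ?thesis
    unfolding a_def[symmetric] b_def[symmetric] c_def[symmetric] d_def[symmetric]
  proof (intro equalityI subsetI)
    fix w assume "w \<in> moeb M ` {z \<in> uhp. P z}"
    then show "w \<in> {w \<in> uhp. P ((of_real d * w - of_real b) / (of_real a - of_real c * w))}"
      using 1 moeb_in_uhp[OF M] by auto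
  next
    fix w assume "w \<in> {w \<in> uhp. P ((of_real d * w - of_real b) / (of_real a - of_real c * w))}"
    then show "w \<in> moeb M ` {z \<in> uhp. P z}"
      using 2[of w] 3[of w] by (auto intro!: image_eqI[of w "moeb M"])
  qed
qed

lemma moeb_imag_axis:
  assumes M: "M \<in> SL2R"
  shows "moeb M ` imag_axis = {w \<in> uhp. (M$1$1 * M$2$2 + M$1$2 * M$2$1) * Re w
     = M$2$1 * M$2$2 * (cmod w)\<^sup>2 + M$1$1 * M$1$2}"
proof -
  have "Re ((of_real d * w - of_real b) / (of_real a - of_real c * w)) = 0 \<longleftrightarrow>
     (a * d + b * c) * Re w = c * d * (cmod w)\<^sup>2 + a * b" if "a*d-b*c = 1" "w \<in> uhp" for a b c d w
  proof -
    have n: "of_real a - of_real c * w \<noteq> 0" using fractional_linear_denominator_nonzero[of d a "-b" "-c" w] that by (simp add: uhp_def mult.commute)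
    then have n2: "(a - c * Re w)\<^sup>2 + (c * Im w)\<^sup>2 \<noteq> 0"
      by (auto simp: complex_eq_iff sum_power2_eq_zero_iff)
    show ?thesis unfolding Re_divide using n2 by (simp add: cmod_power2) (auto simp: algebra_simps power2_eq_square)
  qed
  with SL2R_det[OF M] show ?thesis
    unfolding imag_axis_def moeb_image_eq[OF M] by blast
qed

lemma moeb_unit_semicircle:
  assumes M: "M \<in> SL2R"
  shows "moeb M ` unit_semicircle = {w \<in> uhp. ((M$2$2)\<^sup>2 - (M$2$1)\<^sup>2) * (cmod w)\<^sup>2
     + 2 * (M$1$1 * M$2$1 - M$1$2 * M$2$2) * Re w = (M$1$1)\<^sup>2 - (M$1$2)\<^sup>2}"
proof -
  have "cmod ((of_real d * w - of_real b) / (of_real a - of_real c * w)) = 1 \<longleftrightarrow>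
     (d\<^sup>2 - c\<^sup>2) * (cmod w)\<^sup>2 + 2 * (a * c - b * d) * Re w = a\<^sup>2 - b\<^sup>2" if "a*d-b*c = 1" "w \<in> uhp" for a b c d w
  proof -
    have n: "of_real a - of_real c * w \<noteq> 0" using fractional_linear_denominator_nonzero[of d a "-b" "-c" w] that by (simp add: uhp_def mult.commute)
    have "cmod ((of_real d * w - of_real b) / (of_real a - of_real c * w)) = 1 \<longleftrightarrow>
        (cmod (of_real d * w - of_real b))\<^sup>2 = (cmod (of_real a - of_real c * w))\<^sup>2"
      using n by (simp add: norm_divide divide_eq_eq)
    also have "\<dots> \<longleftrightarrow> (d\<^sup>2 - c\<^sup>2) * (cmod w)\<^sup>2 + 2 * (a * c - b * d) * Re w = a\<^sup>2 - b\<^sup>2"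
      unfolding cmod_power2 by (simp add: algebra_simps power2_eq_square)
    finally show ?thesis .
  qed
  with SL2R_det[OF M] show ?thesis
    unfolding unit_semicircle_def moeb_image_eq[OF M] by blast
qed

text \<open>
  A matrix that preserves the imaginary axis is diagonal or antidiagonal: the equation of the image,
  which holds at \<open>\<i>\<close> and \<open>2\<i>\<close>, forces \<open>c d = a b = 0\<close>.  It therefore sends the unit semicircle to a
  semicircle with the same centre.
\<close>
lemma orthogonal_imag_axis:
  assumes "orthogonal_lines imag_axis D"
  obtains r where "r > 0" "D = {z \<in> uhp. cmod z = r}"
proof -
  obtain M where M: "M \<in> SL2R" and ax: "imag_axis = moeb M ` imag_axis" and D: "D = moeb M ` unit_semicircle"
    using assms by (auto simp: orthogonal_lines_def)
  define a b c d where "a = M$1$1" and "b = M$1$2" and "c = M$2$1" and "d = M$2$2"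
  have dt: "a*d - b*c = 1" using SL2R_det[OF M] by (simp_all add: a_def b_def c_def d_def)
  have "w \<in> uhp \<and> (a*d+b*c) * Re w = c*d*(cmod w)\<^sup>2 + a*b \<longleftrightarrow> w \<in> uhp \<and> Re w = 0" for w
    using ax moeb_imag_axis[OF M] unfolding imag_axis_def a_def b_def c_def d_def by blast
  from this[of \<i>] this[of "2*\<i>"] have "c*d + a*b = 0" "4*(c*d) + a*b = 0"
    by (auto simp: uhp_def norm_mult)
  then have cd: "c*d = 0" "a*b = 0" by linarith+
  have "a*c = 0 \<and> b*d = 0"
  proof (cases "c = 0")
    case True
    then have "a \<noteq> 0" using dt by auto
    then show ?thesis using cd True by simp
  next
    case False
    then have "d = 0" using cd by simp
    then have "b \<noteq> 0" using dt by auto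
    then show ?thesis using cd \<open>d = 0\<close> by simp
  qed
  then have "a*c - b*d = 0" by linarith
  then have Deq: "D = {w \<in> uhp. (d\<^sup>2 - c\<^sup>2) * (cmod w)\<^sup>2 = a\<^sup>2 - b\<^sup>2}"
    using D moeb_unit_semicircle[OF M] by (simp add: a_def b_def c_def d_def)
  obtain q where q: "q > 0" "a\<^sup>2 - b\<^sup>2 = q * (d\<^sup>2 - c\<^sup>2)" "d\<^sup>2 - c\<^sup>2 \<noteq> 0"
  proof (cases "c = 0")
    case True
    then have "a * d = 1" "b = 0" using dt cd by auto
    then have "a \<noteq> 0" "d \<noteq> 0" by auto
    then show ?thesis using True that[of "a\<^sup>2/d\<^sup>2"] \<open>b = 0\<close> by simp
  next
    case False
    then have "d = 0" "b \<noteq> 0" "a = 0" using dt cd by auto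
    then show ?thesis using False that[of "b\<^sup>2/c\<^sup>2"] by simp
  qed
  have "D = {z \<in> uhp. cmod z = sqrt q}"
    unfolding Deq using q(2,3) \<open>q > 0\<close>
    by (auto simp: real_sqrt_unique)
  then show ?thesis using that[of "sqrt q"] q by simp
qed

text \<open>
  The geodesic orthogonal to the semicircle \<open>|z| = r\<close> at its point of angle \<open>\<theta>\<close> with \<open>cos \<theta> = k\<close>.  In the
  coordinate \<open>log z = s + \<i>\<theta>\<close> it is the curve \<open>cos \<theta> = k cosh (s - ln r)\<close>; for \<open>k = 0\<close> it is the
  imaginary axis.
\<close>
definition perp_arc :: "real \<Rightarrow> real \<Rightarrow> complex set" where
  "perp_arc r k = {z \<in> uhp. Re z = cmod z * (k * cosh (ln (cmod z) - ln r))}"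

lemma cosh_ln_diff: assumes "x > 0" "r > (0::real)" shows "cosh (ln x - ln r) = (x\<^sup>2 + r\<^sup>2) / (2 * x * r)"
  using assms by (simp add: cosh_def exp_diff exp_minus field_simps power2_eq_square)

text \<open>
  The image of the imaginary axis under \<open>M\<close> has the equation \<open>(ad + bc) Re z = cd |z|\<^sup>2 + ab\<close>.  That the
  unit semicircle goes to \<open>|z| = r\<close> forces \<open>ab = r\<^sup>2 cd\<close>, which turns the equation into the one of
  \<open>perp_arc r k\<close> with \<open>k = 2rcd / (ad + bc)\<close>.  The matrix is kept in the conclusion because segments
  on the arc are computed through it; its last property says that the modulus is not constant
  along the arc.
\<close>
lemma orthogonal_semicircle:
  assumes o: "orthogonal_lines B {z \<in> uhp. cmod z = r}" and r: "r > 0"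
  obtains k M where "\<bar>k\<bar> < 1" "B = perp_arc r k" "M \<in> SL2R" "B = moeb M ` imag_axis"
    "M$1$1 * M$2$2 + M$1$2 * M$2$1 \<noteq> 0"
proof -
  obtain M where M: "M \<in> SL2R" and B: "B = moeb M ` imag_axis" and D: "{z \<in> uhp. cmod z = r} = moeb M ` unit_semicircle"
    using o by (auto simp: orthogonal_lines_def)
  define a b c d where "a = M$1$1" and "b = M$1$2" and "c = M$2$1" and "d = M$2$2"
  have dt: "a*d - b*c = 1" using SL2R_det[OF M] by (simp_all add: a_def b_def c_def d_def)
  have D': "(d\<^sup>2 - c\<^sup>2) * r\<^sup>2 + 2 * (a*c - b*d) * Re w = a\<^sup>2 - b\<^sup>2" if "w \<in> uhp" "cmod w = r" for w
    using D[unfolded moeb_unit_semicircle[OF M]] that unfolding a_def b_def c_def d_def by blast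
  have e1: "(d\<^sup>2 - c\<^sup>2) * r\<^sup>2 = a\<^sup>2 - b\<^sup>2" using D'[of "of_real r * \<i>"] r by (simp add: uhp_def norm_mult)
  \<comment> \<open>any point of the semicircle off its apex separates the term linear in \<open>Re z\<close>\<close>
  have "cmod (Complex (3/5*r) (4/5*r)) = r"
    using r by (intro power2_eq_imp_eq[of "cmod _"]) (simp_all only: cmod_power2, simp_all add: power2_eq_square)
  then have "(d\<^sup>2 - c\<^sup>2) * r\<^sup>2 + 2 * (a*c - b*d) * (3/5*r) = a\<^sup>2 - b\<^sup>2"
    using D'[of "Complex (3/5*r) (4/5*r)"] r by (simp add: uhp_def)
  with e1 r have e2: "a*c = b*d" by simp
  have "r\<^sup>2 * (d\<^sup>2 - c\<^sup>2) * (c*d) = (a\<^sup>2 - b\<^sup>2) * (c*d)" using e1 by (simp add: mult.commute)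
  also have "\<dots> = a * d * (a * c) - b * c * (b * d)" by (simp add: algebra_simps power2_eq_square)
  also have "\<dots> = a * d * (b * d) - b * c * (a * c)" using e2 by simp
  also have "\<dots> = (a * b) * (d\<^sup>2 - c\<^sup>2)" by (simp add: algebra_simps power2_eq_square)
  finally have "(r\<^sup>2 * (c*d) - a*b) * (d\<^sup>2 - c\<^sup>2) = 0" by (simp add: algebra_simps)
  moreover have "d\<^sup>2 - c\<^sup>2 \<noteq> 0"
  proof
    assume h: "d\<^sup>2 - c\<^sup>2 = 0"
    have "(a*d - b*c)\<^sup>2 = (a\<^sup>2 - b\<^sup>2) * (d\<^sup>2 - c\<^sup>2) + (a*c - b*d)\<^sup>2" by (simp add: algebra_simps power2_eq_square)
    then show False using h e2 dt by simp
  qed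
  ultimately have ab: "a*b = r\<^sup>2 * (c*d)" by simp
  define u where "u = a*d + b*c"
  have "u\<^sup>2 = (a*d - b*c)\<^sup>2 + 4 * (a*b) * (c*d)" by (simp add: u_def algebra_simps power2_eq_square)
  then have u2: "u\<^sup>2 = 1 + (2 * r * (c*d))\<^sup>2" using ab dt by (simp add: algebra_simps power2_eq_square)
  then have u0: "u \<noteq> 0" by (smt (verit) zero_le_power2 zero_power2)
  define k where "k = 2 * r * (c*d) / u"
  have "(2 * r * (c*d))\<^sup>2 < u\<^sup>2" using u2 by simp
  then have "k\<^sup>2 < 1\<^sup>2" using u0 by (simp add: k_def power_divide)
  then have k1: "\<bar>k\<bar> < 1" by (simp add: abs_square_less_1)
  have "B = perp_arc r k"
  proof -
    have "u * Re w = c*d*(cmod w)\<^sup>2 + a*b \<longleftrightarrow> Re w = cmod w * (k * cosh (ln (cmod w) - ln r))" if "w \<in> uhp" for w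
    proof -
      have w: "cmod w > 0" using that by (auto simp: uhp_def)
      have "u * (cmod w * (k * cosh (ln (cmod w) - ln r))) = c * d * (cmod w)\<^sup>2 + r\<^sup>2 * (c*d)"
      proof -
        have "cmod w * cosh (ln (cmod w) - ln r) = ((cmod w)\<^sup>2 + r\<^sup>2) / (2 * r)"
          unfolding cosh_ln_diff[OF w r] using w by simp
        then have "u * (cmod w * (k * cosh (ln (cmod w) - ln r))) = u * k * (((cmod w)\<^sup>2 + r\<^sup>2) / (2 * r))"
          by (simp add: mult.left_commute)
        also have "u * k = 2 * r * (c*d)" using u0 by (simp add: k_def)
        also have "2 * r * (c*d) * (((cmod w)\<^sup>2 + r\<^sup>2) / (2 * r)) = c * d * ((cmod w)\<^sup>2 + r\<^sup>2)"
          using r by simp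
        finally show ?thesis by (simp only: distrib_left mult.commute)
      qed
      then show ?thesis unfolding ab using u0 by (metis mult_left_cancel)
    qed
    then show ?thesis unfolding B moeb_imag_axis[OF M] perp_arc_def
      unfolding u_def a_def b_def c_def d_def by blast
  qed
  then show ?thesis using k1 that[of k M] M B u0 by (simp add: u_def a_def b_def c_def d_def)
qed

section \<open>Geodesic segments\<close>

lemma hdist_commute: "hdist z w = hdist w z"
  by (simp add: hdist_def norm_minus_commute mult.commute mult.left_commute)

lemma hsegment_commute: "hsegment z w = hsegment w z"
  by (auto simp: hsegment_def hdist_commute add.commute)

lemma cosh_hdist: assumes "z \<in> uhp" "w \<in> uhp"
  shows "cosh (hdist z w) = 1 + (cmod (z - w))\<^sup>2 / (2 * Im z * Im w)" "hdist z w \<ge> 0"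
proof -
  have "1 + (cmod (z - w))\<^sup>2 / (2 * Im z * Im w) \<ge> 1" using assms by (simp add: uhp_def)
  then show "cosh (hdist z w) = 1 + (cmod (z - w))\<^sup>2 / (2 * Im z * Im w)" "hdist z w \<ge> 0"
    unfolding hdist_def by (simp_all add: cosh_arcosh_real)
qed

text \<open>
  Here \<open>cosh (hdist p (\<i>y)) = (|p|\<^sup>2 + y\<^sup>2) / (2 y Im p)\<close>, and replacing \<open>Im p\<close> by \<open>|p|\<close> gives
  \<open>cosh (ln |p| - ln y)\<close>, which is smaller unless \<open>Im p = |p|\<close>.
\<close>
lemma hdist_axis:
  assumes p: "p \<in> uhp" and y: "y > 0"
  shows "\<bar>ln (cmod p) - ln y\<bar> \<le> hdist p (of_real y * \<i>)"
    and "\<bar>ln (cmod p) - ln y\<bar> = hdist p (of_real y * \<i>) \<longleftrightarrow> Re p = 0"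
proof -
  have ip: "Im p > 0" and np: "cmod p > 0" and le: "Im p \<le> cmod p"
    using p abs_Im_le_cmod[of p] by (auto simp: uhp_def)
  have yu: "of_real y * \<i> \<in> uhp" using y by (simp add: uhp_def)
  have c: "cosh (hdist p (of_real y * \<i>)) = ((cmod p)\<^sup>2 + y\<^sup>2) / (2 * y * Im p)"
    unfolding cosh_hdist(1)[OF p yu] cmod_power2 using ip y by (simp add: field_simps power2_eq_square)
  have c': "cosh \<bar>ln (cmod p) - ln y\<bar> = ((cmod p)\<^sup>2 + y\<^sup>2) / (2 * y * cmod p)"
    using cosh_ln_diff[OF np y] by (simp add: mult.commute mult.left_commute)
  have pos: "(cmod p)\<^sup>2 + y\<^sup>2 > 0" using y by (simp add: add_nonneg_pos)
  have "cosh \<bar>ln (cmod p) - ln y\<bar> \<le> cosh (hdist p (of_real y * \<i>))"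
    unfolding c c' using le ip np y pos by (intro divide_left_mono mult_left_mono) auto
  then show "\<bar>ln (cmod p) - ln y\<bar> \<le> hdist p (of_real y * \<i>)"
    using cosh_hdist(2)[OF p yu] by (simp add: cosh_real_nonneg_le_iff del: cosh_real_abs)
  have "\<bar>ln (cmod p) - ln y\<bar> = hdist p (of_real y * \<i>) \<longleftrightarrow>
     cosh \<bar>ln (cmod p) - ln y\<bar> = cosh (hdist p (of_real y * \<i>))"
    using cosh_hdist(2)[OF p yu] by (metis abs_ge_zero arcosh_cosh_real)
  also have "\<dots> \<longleftrightarrow> Im p = cmod p"
    unfolding c c' using pos y ip np by (simp add: frac_eq_eq) (auto simp: power2_eq_square)
  also have "\<dots> \<longleftrightarrow> Re p = 0"
  proof
    assume "Im p = cmod p"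
    then have "(Im p)\<^sup>2 = (Re p)\<^sup>2 + (Im p)\<^sup>2" using cmod_power2[of p] by simp
    then show "Re p = 0" by simp
  qed (use ip in \<open>simp add: cmod_eq_Im\<close>)
  finally show "\<bar>ln (cmod p) - ln y\<bar> = hdist p (of_real y * \<i>) \<longleftrightarrow> Re p = 0" .
qed

text \<open>
  If the triangle inequality is an equality at \<open>p\<close>, then so are both comparisons with the
  difference of logarithms, hence \<open>p\<close> lies on the axis.
\<close>
lemma hsegment_axis:
  assumes "0 < y1" "y1 \<le> y2"
  shows "hsegment (of_real y1 * \<i>) (of_real y2 * \<i>) = (\<lambda>y. of_real y * \<i>) ` {y1..y2}"
proof -
  have y2: "y2 > 0" using assms by simp
  have d0: "hdist (of_real y1 * \<i>) (of_real y2 * \<i>) = ln y2 - ln y1"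
    using hdist_axis(2)[of "of_real y1 * \<i>" y2] assms by (simp add: uhp_def norm_mult)
  show ?thesis
  proof (intro equalityI subsetI)
    fix p assume p: "p \<in> hsegment (of_real y1 * \<i>) (of_real y2 * \<i>)"
    then have pu: "p \<in> uhp" and s: "hdist p (of_real y1 * \<i>) + hdist p (of_real y2 * \<i>) = ln y2 - ln y1"
      using d0 by (auto simp: hsegment_def hdist_commute)
    have np: "cmod p > 0" using pu by (auto simp: uhp_def)
    note a = hdist_axis(1)[OF pu assms(1)] hdist_axis(1)[OF pu y2]
    have "\<bar>ln (cmod p) - ln y1\<bar> = hdist p (of_real y1 * \<i>)" using a s by linarith
    then have r: "Re p = 0" using hdist_axis(2)[OF pu assms(1)] by simp
    have "ln y1 \<le> ln (cmod p)" "ln (cmod p) \<le> ln y2" using a s by linarith+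
    then have "y1 \<le> cmod p" "cmod p \<le> y2" using np assms y2 by simp_all
    moreover have "cmod p = Im p" using r pu by (simp add: uhp_def cmod_eq_Im)
    ultimately show "p \<in> (\<lambda>y. of_real y * \<i>) ` {y1..y2}"
      using r by (intro image_eqI[of _ _ "Im p"]) (auto simp: complex_eq_iff)
  next
    fix p assume "p \<in> (\<lambda>y. of_real y * \<i>) ` {y1..y2}"
    then obtain y where y: "y1 \<le> y" "y \<le> y2" and p: "p = of_real y * \<i>" by auto
    have "p \<in> uhp" "y > 0" using y assms by (auto simp: p uhp_def)
    moreover have "hdist p (of_real y1 * \<i>) = \<bar>ln y - ln y1\<bar>" "hdist p (of_real y2 * \<i>) = \<bar>ln y - ln y2\<bar>"
      using hdist_axis(2)[OF \<open>p \<in> uhp\<close> assms(1)] hdist_axis(2)[OF \<open>p \<in> uhp\<close> y2] \<open>y > 0\<close>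
      by (simp_all add: p norm_mult)
    ultimately show "p \<in> hsegment (of_real y1 * \<i>) (of_real y2 * \<i>)"
      using y assms d0 y2 by (simp add: hsegment_def hdist_commute)
  qed
qed

lemma moeb_image_uhp: "M \<in> SL2R \<Longrightarrow> moeb M ` uhp = uhp"
  using moeb_image_eq[of M "\<lambda>_. True"] by simp

lemma hsegment_moeb:
  assumes M: "M \<in> SL2R" and z: "z \<in> uhp" and w: "w \<in> uhp"
  shows "hsegment (moeb M z) (moeb M w) = moeb M ` hsegment z w"
proof -
  have "hsegment (moeb M z) (moeb M w) = {p \<in> moeb M ` uhp. hdist (moeb M z) p + hdist p (moeb M w) = hdist z w}"
    unfolding moeb_image_uhp[OF M] hsegment_def hdist_moeb[OF M z w] ..
  also have "\<dots> = moeb M ` hsegment z w"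
    using hdist_moeb[OF M] z w by (auto simp: hsegment_def)
  finally show ?thesis .
qed

lemma imag_axis_param: "imag_axis = (\<lambda>y. of_real y * \<i>) ` {0<..}"
proof (intro equalityI subsetI)
  fix p assume "p \<in> imag_axis"
  then show "p \<in> (\<lambda>y. of_real y * \<i>) ` {0<..}"
    by (intro image_eqI[of _ _ "Im p"]) (auto simp: complex_eq_iff imag_axis_def uhp_def)
qed (auto simp: imag_axis_def uhp_def)

lemma hsegment_geodesic:
  assumes "M \<in> SL2R" "0 < y1" "y1 \<le> y2"
  shows "hsegment (moeb M (of_real y1 * \<i>)) (moeb M (of_real y2 * \<i>)) = (\<lambda>y. moeb M (of_real y * \<i>)) ` {y1..y2}"
  using assms by (subst hsegment_moeb) (auto simp: uhp_def hsegment_axis image_image)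

text \<open>
  \<open>|M(\<i>y)|\<^sup>2 = (a\<^sup>2y\<^sup>2 + b\<^sup>2) / (c\<^sup>2y\<^sup>2 + d\<^sup>2)\<close> is monotone in \<open>y\<close>, in the direction given by the sign of
  \<open>a\<^sup>2d\<^sup>2 - b\<^sup>2c\<^sup>2 = ad + bc\<close>.
\<close>
lemma moeb_axis_modulus:
  assumes M: "M \<in> SL2R" and y: "0 < y" "0 < y'"
  shows "M$1$1 * M$2$2 + M$1$2 * M$2$1 > 0 \<Longrightarrow> cmod (moeb M (of_real y * \<i>)) \<le> cmod (moeb M (of_real y' * \<i>)) \<longleftrightarrow> y \<le> y'"
    and "M$1$1 * M$2$2 + M$1$2 * M$2$1 < 0 \<Longrightarrow> cmod (moeb M (of_real y * \<i>)) \<le> cmod (moeb M (of_real y' * \<i>)) \<longleftrightarrow> y' \<le> y"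
proof -
  define a b c d where "a = M$1$1" and "b = M$1$2" and "c = M$2$1" and "d = M$2$2"
  have dt: "a*d - b*c = 1" using SL2R_det[OF M] by (simp_all add: a_def b_def c_def d_def)
  have sq: "(cmod (moeb M (of_real x * \<i>)))\<^sup>2 = ((a*x)\<^sup>2 + b\<^sup>2) / ((c*x)\<^sup>2 + d\<^sup>2)" and ps: "(c*x)\<^sup>2 + d\<^sup>2 > 0" if "x > 0" for x
  proof -
    show "(c*x)\<^sup>2 + d\<^sup>2 > 0"
      using dt that by (auto simp: sum_power2_gt_zero_iff)
    show "(cmod (moeb M (of_real x * \<i>)))\<^sup>2 = ((a*x)\<^sup>2 + b\<^sup>2) / ((c*x)\<^sup>2 + d\<^sup>2)"
      by (simp add: moeb_def norm_divide power_divide cmod_power2 a_def b_def c_def d_def add.commute)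
  qed
  have "cmod (moeb M (of_real y * \<i>)) \<le> cmod (moeb M (of_real y' * \<i>)) \<longleftrightarrow>
      (cmod (moeb M (of_real y * \<i>)))\<^sup>2 \<le> (cmod (moeb M (of_real y' * \<i>)))\<^sup>2"
    by (simp add: power_mono_iff)
  also have "\<dots> \<longleftrightarrow> ((a*y)\<^sup>2 + b\<^sup>2) * ((c*y')\<^sup>2 + d\<^sup>2) \<le> ((a*y')\<^sup>2 + b\<^sup>2) * ((c*y)\<^sup>2 + d\<^sup>2)"
  proof -
    have "u / p \<le> v / q \<longleftrightarrow> u * q \<le> v * p" if "p > 0" "q > 0" for u v p q :: real
      using that by (simp add: field_simps)
    then show ?thesis unfolding sq[OF y(1)] sq[OF y(2)] using ps[OF y(1)] ps[OF y(2)] by blast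
  qed
  also have "\<dots> \<longleftrightarrow> 0 \<le> (a*d + b*c) * (a*d - b*c) * (y'\<^sup>2 - y\<^sup>2)"
    by (simp add: algebra_simps power2_eq_square)
  finally have m: "cmod (moeb M (of_real y * \<i>)) \<le> cmod (moeb M (of_real y' * \<i>)) \<longleftrightarrow> 0 \<le> (a*d + b*c) * (y'\<^sup>2 - y\<^sup>2)"
    using dt by simp
  show "M$1$1 * M$2$2 + M$1$2 * M$2$1 > 0 \<Longrightarrow> cmod (moeb M (of_real y * \<i>)) \<le> cmod (moeb M (of_real y' * \<i>)) \<longleftrightarrow> y \<le> y'"
    using m y by (simp add: zero_le_mult_iff a_def b_def c_def d_def power_mono_iff)
  show "M$1$1 * M$2$2 + M$1$2 * M$2$1 < 0 \<Longrightarrow> cmod (moeb M (of_real y * \<i>)) \<le> cmod (moeb M (of_real y' * \<i>)) \<longleftrightarrow> y' \<le> y"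
    using m y by (simp add: zero_le_mult_iff a_def b_def c_def d_def power_mono_iff)
qed

lemma hsegment_by_modulus:
  assumes M: "M \<in> SL2R" "M$1$1 * M$2$2 + M$1$2 * M$2$1 \<noteq> 0"
    and z: "z \<in> moeb M ` imag_axis" and w: "w \<in> moeb M ` imag_axis" and le: "cmod z \<le> cmod w"
  shows "hsegment z w = {p \<in> moeb M ` imag_axis. cmod z \<le> cmod p \<and> cmod p \<le> cmod w}"
proof -
  obtain y1 y2 where y: "y1 > 0" "y2 > 0" and zw: "z = moeb M (of_real y1 * \<i>)" "w = moeb M (of_real y2 * \<i>)"
    using z w by (auto simp: imag_axis_param)
  show ?thesis
  proof (cases "M$1$1 * M$2$2 + M$1$2 * M$2$1 > 0")
    case True
    note m = moeb_axis_modulus(1)[OF M(1) _ _ True]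
    have "y1 \<le> y2" using le m y by (simp add: zw)
    then show ?thesis unfolding zw hsegment_geodesic[OF M(1) y(1) \<open>y1 \<le> y2\<close>]
      using m y by (fastforce simp: imag_axis_param)
  next
    case False
    then have "M$1$1 * M$2$2 + M$1$2 * M$2$1 < 0" using M(2) by simp
    note m = moeb_axis_modulus(2)[OF M(1) _ _ this]
    have "y2 \<le> y1" using le m y by (simp add: zw)
    then show ?thesis unfolding zw hsegment_commute[of "moeb M (of_real y1 * \<i>)"] hsegment_geodesic[OF M(1) y(2) \<open>y2 \<le> y1\<close>]
      using m y by (fastforce simp: imag_axis_param)
  qed
qed

section \<open>Distance to a lattice\<close>

definition lattice_dist :: "real \<Rightarrow> real \<Rightarrow> real" where
  "lattice_dist l x = \<bar>x - l * of_int (round (x / l))\<bar>"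

lemma lattice_dist_le: assumes "l > 0" shows "lattice_dist l x \<le> \<bar>x - l * of_int m\<bar>"
proof -
  have e: "\<bar>x - l * of_int j\<bar> = l * \<bar>x / l - of_int j\<bar>" for j
    using assms by (simp add: abs_mult_pos' right_diff_distrib)
  show ?thesis unfolding lattice_dist_def e using assms round_diff_minimal[of "x/l" m] by simp
qed

lemma lattice_dist_le_half: assumes "l > 0" shows "lattice_dist l x \<le> l / 2"
proof -
  have "lattice_dist l x = l * \<bar>of_int (round (x / l)) - x / l\<bar>"
    unfolding lattice_dist_def using assms by (simp add: abs_mult_pos' right_diff_distrib abs_minus_commute)
  also have "\<dots> \<le> l * (1/2)" using assms of_int_round_abs_le[of "x/l"] by (intro mult_left_mono) auto
  finally show ?thesis by simp
qed

lemma lattice_dist_nonneg [simp]: "lattice_dist l x \<ge> 0"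
  by (simp add: lattice_dist_def)

lemma lattice_dist_small: assumes "l > 0" "\<bar>x\<bar> \<le> l / 2" shows "lattice_dist l x = \<bar>x\<bar>"
proof (rule antisym)
  show "lattice_dist l x \<le> \<bar>x\<bar>" using lattice_dist_le[OF assms(1), of x 0] by simp
  define j where "j = round (x / l)"
  show "\<bar>x\<bar> \<le> lattice_dist l x"
  proof (cases "j = 0")
    case False
    then have "\<bar>real_of_int j\<bar> \<ge> 1" by linarith
    then have "\<bar>l * of_int j\<bar> \<ge> l * 1" using assms(1) unfolding abs_mult by (intro mult_mono) auto
    then show ?thesis using assms unfolding lattice_dist_def j_def by linarith
  qed (simp add: lattice_dist_def j_def)
qed

lemma lattice_dist_shift: assumes "l > 0" shows "lattice_dist l (of_int m * l + x) = lattice_dist l x"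
proof (rule antisym)
  define i j where "i = round (x / l)" and "j = round ((of_int m * l + x) / l)"
  show "lattice_dist l (of_int m * l + x) \<le> lattice_dist l x"
    using lattice_dist_le[OF assms, of "of_int m * l + x" "m + i"]
    by (simp add: lattice_dist_def i_def algebra_simps)
  show "lattice_dist l x \<le> lattice_dist l (of_int m * l + x)"
    using lattice_dist_le[OF assms, of "x" "j - m"]
    by (simp add: lattice_dist_def j_def algebra_simps)
qed

lemma lattice_dist_lipschitz: assumes "l > 0" shows "\<bar>lattice_dist l x - lattice_dist l y\<bar> \<le> \<bar>x - y\<bar>"
proof -
  have "lattice_dist l u \<le> lattice_dist l v + \<bar>u - v\<bar>" for u v
    using lattice_dist_le[OF assms, of u "round (v / l)"] unfolding lattice_dist_def by linarith
  from this[of x y] this[of y x] show ?thesis by linarith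
qed

lemma continuous_lattice_dist: assumes "l > 0" shows "continuous_on A (lattice_dist l)"
proof -
  have "continuous (at x) (lattice_dist l)" for x
    unfolding continuous_at_eps_delta dist_real_def
    using lattice_dist_lipschitz[OF assms] by (blast intro: le_less_trans)
  then show ?thesis by (simp add: continuous_at_imp_continuous_on)
qed

section \<open>The lift of the boundary loop\<close>

lemma abs_eq_if_cosh_eq: "cosh x = cosh y \<Longrightarrow> \<bar>x\<bar> = \<bar>y\<bar>" for x y :: real
  by (metis abs_ge_zero arcosh_cosh_real cosh_real_abs)

lemma perp_arc_0: "perp_arc r 0 = imag_axis"
  by (simp add: perp_arc_def imag_axis_def)

text \<open>
  There is only one perpendicular to the semicircle at a given point.
\<close>
lemma perp_arc_determined_by_foot: "Re c = r * k \<Longrightarrow> c \<in> perp_arc r k' \<Longrightarrow> cmod c = r \<Longrightarrow> r > 0 \<Longrightarrow> k' = k"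
  by (simp add: perp_arc_def)

text \<open>
  The two perpendiculars from \<open>b\<close> and \<open>exp l * b\<close> have the same foot on \<open>perp2\<close>, so they lie on one
  geodesic \<open>perp_arc r2 k\<close>.  It meets the ray through \<open>b\<close> in points placed symmetrically about \<open>|z| = r2\<close>,
  whence \<open>r2 = exp (l/2) r1\<close>: the foot of \<open>\<eta>\<close> is half a period away from the foot of \<open>\<gamma>\<close>.  For a
  puncture the same holds for the two ideal endpoints of the loop.  The inequality for \<open>k\<close> says that
  \<open>|cos \<theta>| \<le> 1\<close> at the ends of the loop, with equality at a puncture.
\<close>
lemma loop_eq_perp_arc_part:
  assumes hc: "half_collar l X" and l: "l > 0"
  obtains k r1 r2 where "r1 > 0" "foot1 X = of_real r1 * \<i>" "foot2 X = of_real r2 * \<i>"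
    "ln r2 = ln r1 + l / 2" "r2 > 0" "k \<noteq> 0" "\<bar>k\<bar> * cosh (l / 2) \<le> 1"
    "cross X \<in> uhp" "cmod (cross X) = r2" "Re (cross X) = r2 * k"
    "loop X = {p \<in> perp_arc r2 k. \<bar>ln (cmod p) - ln r2\<bar> \<le> l / 2}"
proof -
  have o1: "simple_orthogeodesic (deck X) (cover X) (comp1 X) (perp1 X)"
    and o2: "simple_orthogeodesic (deck X) (cover X) (comp2 X) (perp2 X)"
    and f: "foot1 X \<in> imag_axis \<inter> perp1 X" "foot2 X \<in> imag_axis \<inter> perp2 X"
    and cr: "cross X \<in> perp2 X \<inter> cover X"
    using hc by (auto simp: half_collar_def)
  obtain r1 where r1: "r1 > 0" and p1: "perp1 X = {z \<in> uhp. cmod z = r1}"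
    using o1 orthogonal_imag_axis unfolding simple_orthogeodesic_def by metis
  obtain r2 where r2: "r2 > 0" and p2: "perp2 X = {z \<in> uhp. cmod z = r2}"
    using o2 orthogonal_imag_axis unfolding simple_orthogeodesic_def by metis
  have f1: "foot1 X = of_real r1 * \<i>" and f2: "foot2 X = of_real r2 * \<i>"
    using f by (auto simp: p1 p2 imag_axis_def uhp_def cmod_eq_Im complex_eq_iff)
  have c: "cross X \<in> uhp" "cmod (cross X) = r2" using cr by (auto simp: p2)
  have "ln r2 = ln r1 + l / 2 \<and> (\<exists>k. k \<noteq> 0 \<and> \<bar>k\<bar> * cosh (l / 2) \<le> 1 \<and> Re (cross X) = r2 * k \<and>
     loop X = {p \<in> perp_arc r2 k. \<bar>ln (cmod p) - ln r2\<bar> \<le> l / 2})"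
  proof (cases "comp1 X")
    case (Geodesic A)
    obtain b where b: "b \<in> perp1 X \<inter> A" and pf1: "perp_foot b (perp2 X) (cross X)"
      and pf2: "perp_foot (of_real (exp l) * b) (perp2 X) (cross X)"
      and lp: "loop X = hsegment b (cross X) \<union> hsegment (cross X) (of_real (exp l) * b)"
      using hc Geodesic by (auto simp: half_collar_def)
    obtain B where B: "orthogonal_lines B (perp2 X)" "b \<in> B" "cross X \<in> B"
      using pf1 by (auto simp: perp_foot_def)
    obtain B' where B': "orthogonal_lines B' (perp2 X)" "of_real (exp l) * b \<in> B'" "cross X \<in> B'"
      using pf2 by (auto simp: perp_foot_def)
    obtain k M where k: "B = perp_arc r2 k" and M: "M \<in> SL2R" "B = moeb M ` imag_axis"
      "M$1$1 * M$2$2 + M$1$2 * M$2$1 \<noteq> 0"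
      using B(1) r2 unfolding p2 by (elim orthogonal_semicircle)
    obtain k' where k': "B' = perp_arc r2 k'"
      using B'(1) r2 unfolding p2 by (elim orthogonal_semicircle)
    have rc: "Re (cross X) = r2 * k" using B(3) c by (simp add: k perp_arc_def)
    have "k' = k" using perp_arc_determined_by_foot[OF rc, of k'] B'(3) c r2 unfolding k' by blast
    then have B'eq: "B' = B" by (simp add: k k')
    have bu: "b \<in> uhp" "cmod b = r1" using b by (auto simp: p1)
    have e1: "Re b = r1 * (k * cosh (ln r1 - ln r2))" using B(2) bu by (simp add: k perp_arc_def)
    have "exp l * Re b = exp l * r1 * (k * cosh (ln (exp l * r1) - ln r2))"
      using B'(2) bu unfolding B'eq k perp_arc_def by (simp add: norm_mult)
    then have e2: "Re b = r1 * (k * cosh (l + ln r1 - ln r2))" using r1 by (simp add: ln_mult)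
    \<comment> \<open>for \<open>k = 0\<close> the point \<open>b\<close> would be the foot of \<open>\<gamma>\<close>, so that \<open>\<alpha>\<close> and \<open>\<alpha>\<^sub>1\<close> would coincide\<close>
    have k0: "k \<noteq> 0"
    proof
      assume "k = 0"
      then have "Re b = 0" using e1 by simp
      have "orthogonal_lines A (perp1 X)" using o1 Geodesic by (simp add: simple_orthogeodesic_def)
      then obtain kA where "A = perp_arc r1 kA" using r1 unfolding p1 by (elim orthogonal_semicircle)
      moreover have "kA = 0" using \<open>Re b = 0\<close> b bu r1 perp_arc_determined_by_foot[of b r1 0 kA] unfolding \<open>A = perp_arc r1 kA\<close>
        by auto
      ultimately have "A = imag_axis" by (simp add: perp_arc_0)
      have "\<not> same_boundary (deck X) (Geodesic imag_axis) (Geodesic A)" "mat 1 \<in> deck X"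
        using hc Geodesic by (auto simp: half_collar_def geodesic_pants_def hyperbolic_surface_def fuchsian_def)
      moreover have "moeb (mat 1) ` imag_axis = imag_axis" by (simp add: moeb_def mat_def)
      ultimately show False using \<open>A = imag_axis\<close> by auto
    qed
    have "cosh (ln r1 - ln r2) = cosh (l + ln r1 - ln r2)" using e1 e2 k0 r1 by simp
    then have "\<bar>ln r1 - ln r2\<bar> = \<bar>l + ln r1 - ln r2\<bar>" by (rule abs_eq_if_cosh_eq)
    then have lnr: "ln r2 = ln r1 + l / 2" using l by linarith
    have "\<bar>Re b\<bar> = r1 * (\<bar>k\<bar> * cosh (l/2))" unfolding e1 using r1 lnr by (simp add: abs_mult)
    then have kc: "\<bar>k\<bar> * cosh (l/2) \<le> 1" using abs_Re_le_cmod[of b] bu r1 by simp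
    have le: "cmod b \<le> cmod (cross X)" "cmod (cross X) \<le> cmod (of_real (exp l) * b)"
    proof -
      show "cmod b \<le> cmod (cross X)" using bu c r1 r2 lnr l by (simp flip: ln_le_cancel_iff)
      have "ln r2 \<le> ln (exp l * r1)" using lnr l r1 by (simp add: ln_mult)
      then show "cmod (cross X) \<le> cmod (of_real (exp l) * b)" using bu c r1 r2 by (simp add: norm_mult)
    qed
    have "loop X = {p \<in> B. cmod b \<le> cmod p \<and> cmod p \<le> cmod (of_real (exp l) * b)}"
      unfolding lp using hsegment_by_modulus[OF M(1,3), of b "cross X"] hsegment_by_modulus[OF M(1,3), of "cross X" "of_real (exp l) * b"]
        B B' B'eq le unfolding M(2)[symmetric] by auto
    also have "\<dots> = {p \<in> perp_arc r2 k. \<bar>ln (cmod p) - ln r2\<bar> \<le> l / 2}"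
    proof -
      have "cmod b \<le> cmod p \<and> cmod p \<le> cmod (of_real (exp l) * b) \<longleftrightarrow> \<bar>ln (cmod p) - ln r2\<bar> \<le> l / 2" if "p \<in> uhp" for p
      proof -
        have p: "cmod p > 0" using that by (auto simp: uhp_def)
        have "cmod b \<le> cmod p \<longleftrightarrow> ln r1 \<le> ln (cmod p)" using p r1 bu by simp
        moreover have "cmod p \<le> cmod (of_real (exp l) * b) \<longleftrightarrow> ln (cmod p) \<le> ln (exp l * r1)" using p r1 bu by (simp add: norm_mult)
        moreover have "ln (exp l * r1) = l + ln r1" using r1 by (simp add: ln_mult)
        ultimately show ?thesis using lnr by (smt (verit) field_sum_of_halves)
      qed
      then show ?thesis unfolding k perp_arc_def by blast
    qed
    finally show ?thesis using lnr k0 kc rc by blast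
  next
    case (Puncture u)
    have o: "orthogonal_lines (loop X) (perp2 X)" and cl: "cross X \<in> loop X"
      and u1: "of_real u \<in> closure (loop X)" and u2: "of_real (exp l * u) \<in> closure (loop X)"
      using hc Puncture by (auto simp: half_collar_def)
    obtain k where k: "loop X = perp_arc r2 k"
      using o r2 unfolding p2 by (elim orthogonal_semicircle)
    have rc: "Re (cross X) = r2 * k" using cl c by (simp add: k perp_arc_def)
    have "closure (perp1 X) \<subseteq> {z. cmod z = r1}"
      unfolding p1 by (intro closure_minimal closed_Collect_eq continuous_intros) auto
    moreover have "of_real u \<in> closure (perp1 X)"
      using o1 Puncture by (simp add: simple_orthogeodesic_def)
    ultimately have ur: "\<bar>u\<bar> = r1" by auto
    \<comment> \<open>both ideal endpoints satisfy the equation of the circle that carries the loop\<close>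
    have "closure (loop X) \<subseteq> {z. 2 * r2 * Re z = k * ((cmod z)\<^sup>2 + r2\<^sup>2)}"
    proof (intro closure_minimal closed_Collect_eq continuous_intros subsetI CollectI)
      fix z assume "z \<in> loop X"
      then have z: "cmod z > 0" "Re z = cmod z * (k * cosh (ln (cmod z) - ln r2))" by (auto simp: k perp_arc_def uhp_def)
      show "2 * r2 * Re z = k * ((cmod z)\<^sup>2 + r2\<^sup>2)"
        unfolding z(2) cosh_ln_diff[OF z(1) r2] using z(1) r2 by (simp add: field_simps)
    qed
    then have q1: "2 * r2 * u = k * (u\<^sup>2 + r2\<^sup>2)" and q2: "2 * r2 * (exp l * u) = k * ((exp l * u)\<^sup>2 + r2\<^sup>2)"
      using u1 u2 by (auto simp: subset_iff norm_mult abs_mult power_mult_distrib simp del: of_real_mult)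
    have k0: "k \<noteq> 0" using q1 r2 ur r1 by auto
    have "k * (exp l * (u\<^sup>2 + r2\<^sup>2)) = exp l * (2 * r2 * u)" unfolding q1 by (simp add: mult.left_commute)
    also have "\<dots> = k * ((exp l * u)\<^sup>2 + r2\<^sup>2)" unfolding q2[symmetric] by simp
    finally have "k * (exp l * (u\<^sup>2 + r2\<^sup>2)) = k * ((exp l * u)\<^sup>2 + r2\<^sup>2)" .
    then have "exp l * (u\<^sup>2 + r2\<^sup>2) = (exp l * u)\<^sup>2 + r2\<^sup>2" using k0 by simp
    then have "(exp l - 1) * (r2\<^sup>2 - exp l * u\<^sup>2) = 0" by (simp add: algebra_simps power2_eq_square)
    then have "r2\<^sup>2 = exp l * r1\<^sup>2" using l ur by (auto simp: power2_eq_square)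
    then have "ln (r2\<^sup>2) = ln (exp l * r1\<^sup>2)" by simp
    then have lnr: "ln r2 = ln r1 + l / 2" using r1 r2 by (simp add: ln_mult ln_realpow)
    have "cosh (l/2) = cosh (ln r1 - ln r2)" by (simp add: lnr)
    also have "\<dots> = (r1\<^sup>2 + r2\<^sup>2) / (2 * r1 * r2)" by (rule cosh_ln_diff[OF r1 r2])
    finally have "\<bar>k\<bar> * cosh (l/2) = \<bar>k * (u\<^sup>2 + r2\<^sup>2)\<bar> / (2 * r1 * r2)" by (simp add: abs_mult flip: ur)
    also have "\<dots> = 1" unfolding q1[symmetric] using ur r1 r2 by (simp add: abs_mult)
    finally have kc: "\<bar>k\<bar> * cosh (l/2) = 1" .
    \<comment> \<open>the whole geodesic lies in one period, since it ends where \<open>cos \<theta>\<close> reaches 1\<close>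
    have "\<bar>ln (cmod p) - ln r2\<bar> \<le> l / 2" if "p \<in> perp_arc r2 k" for p
    proof -
      have p: "cmod p > 0" "Re p = cmod p * (k * cosh (ln (cmod p) - ln r2))" using that by (auto simp: perp_arc_def uhp_def)
      have "cmod p * (\<bar>k\<bar> * cosh (ln (cmod p) - ln r2)) \<le> cmod p * 1"
        using abs_Re_le_cmod[of p] unfolding p(2) by (simp add: abs_mult)
      then have "\<bar>k\<bar> * cosh (ln (cmod p) - ln r2) \<le> \<bar>k\<bar> * cosh (l/2)" unfolding kc using p(1) by simp
      then have "cosh \<bar>ln (cmod p) - ln r2\<bar> \<le> cosh (l/2)" using k0 by simp
      then show ?thesis using l by (simp add: cosh_real_nonneg_le_iff del: cosh_real_abs)
    qed
    then show ?thesis using lnr k0 kc rc k by auto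
  qed
  then show ?thesis using that[of r1 r2] r1 r2 f1 f2 c by blast
qed

text \<open>
  Every point has a translate in the period centred at \<open>ln |z| = ln r\<close>, and there \<open>|ln |z| - ln r|\<close> is the
  distance to the lattice.
\<close>
lemma beta_lift_eq_periodic_graph:
  assumes l: "l > 0" and lp: "loop X = {p \<in> perp_arc r k. \<bar>ln (cmod p) - ln r\<bar> \<le> l / 2}"
  shows "beta_lift l X = {p \<in> uhp. Re p = cmod p * (k * cosh (lattice_dist l (ln (cmod p) - ln r)))}"
proof (intro equalityI subsetI)
  fix p assume "p \<in> beta_lift l X"
  then obtain m :: int and q where p: "p = of_real (exp (of_int m * l)) * q" and q: "q \<in> loop X"
    by (auto simp: beta_lift_def)
  have qu: "q \<in> uhp" "cmod q > 0" and qr: "Re q = cmod q * (k * cosh (ln (cmod q) - ln r))" "\<bar>ln (cmod q) - ln r\<bar> \<le> l / 2"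
    using q by (auto simp: lp perp_arc_def uhp_def)
  have np: "cmod p = exp (of_int m * l) * cmod q" "Re p = exp (of_int m * l) * Re q" and pu: "p \<in> uhp"
    using qu by (auto simp: p norm_mult uhp_def)
  have "ln (cmod p) - ln r = of_int m * l + (ln (cmod q) - ln r)" using qu by (simp add: np ln_mult)
  then have "lattice_dist l (ln (cmod p) - ln r) = \<bar>ln (cmod q) - ln r\<bar>"
    using lattice_dist_shift[OF l] lattice_dist_small[OF l qr(2)] by metis
  then show "p \<in> {p \<in> uhp. Re p = cmod p * (k * cosh (lattice_dist l (ln (cmod p) - ln r)))}"
    using pu by (simp add: np qr(1))
next
  fix p assume "p \<in> {p \<in> uhp. Re p = cmod p * (k * cosh (lattice_dist l (ln (cmod p) - ln r)))}"
  then have pu: "p \<in> uhp" "cmod p > 0" and pr: "Re p = cmod p * (k * cosh (lattice_dist l (ln (cmod p) - ln r)))"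
    by (auto simp: uhp_def)
  define m where "m = round ((ln (cmod p) - ln r) / l)"
  define q where "q = of_real (exp (- of_int m * l)) * p"
  have nq: "cmod q = exp (- of_int m * l) * cmod p" "Re q = exp (- of_int m * l) * Re p" and qu: "q \<in> uhp"
    using pu by (auto simp: q_def norm_mult uhp_def)
  have "ln (cmod q) = ln (cmod p) - of_int m * l" using pu by (simp add: nq ln_mult)
  then have d: "lattice_dist l (ln (cmod p) - ln r) = \<bar>ln (cmod q) - ln r\<bar>"
    by (simp add: lattice_dist_def m_def algebra_simps)
  then have "\<bar>ln (cmod q) - ln r\<bar> \<le> l / 2" using lattice_dist_le_half[OF l, of "ln (cmod p) - ln r"] by simp
  moreover have "q \<in> perp_arc r k" using qu pr unfolding d by (simp add: perp_arc_def nq)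
  moreover have "p = of_real (exp (of_int m * l)) * q"
    by (simp add: q_def exp_minus)
  ultimately show "p \<in> beta_lift l X"
    unfolding beta_lift_def lp by blast
qed

section \<open>The shape of a half-collar\<close>

text \<open>
  The matrix below sends the imaginary axis to the semicircle with centre \<open>x\<close> and radius \<open>R\<close>, and
  the real part is increasing along it.
\<close>
lemma circle_hsegment:
  assumes u: "z \<in> uhp" "p \<in> uhp" "w \<in> uhp"
    and R: "cmod (z - of_real x) = R" "cmod (p - of_real x) = R" "cmod (w - of_real x) = R"
    and le: "Re z \<le> Re p" "Re p \<le> Re w"
  shows "p \<in> hsegment z w"
proof -
  define Y where "Y q = Im q / (R - (Re q - x))" for q
  have R0: "R > 0" using R(1) u(1) by (auto simp: uhp_def)
  define M :: "real^2^2" where "M = vector [vector [(x+R) / sqrt (2*R), (x-R) / sqrt (2*R)], vector [1 / sqrt (2*R), 1 / sqrt (2*R)]]"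
  have M: "M \<in> SL2R" using R0 by (simp add: SL2R_def M_def det_2 diff_divide_distrib[symmetric])
  have circ: "R - (Re q - x) > 0" "R + (Re q - x) > 0" "(Im q)\<^sup>2 = (R - (Re q - x)) * (R + (Re q - x))"
    if "q \<in> uhp" "cmod (q - of_real x) = R" for q
  proof -
    have "(Re q - x)\<^sup>2 + (Im q)\<^sup>2 = R\<^sup>2" using cmod_power2[of "q - of_real x"] that by simp
    then show e: "(Im q)\<^sup>2 = (R - (Re q - x)) * (R + (Re q - x))" by (simp add: algebra_simps power2_eq_square)
    have "(R - (Re q - x)) * (R + (Re q - x)) > 0" using that unfolding e[symmetric] by (simp add: uhp_def)
    then show "R - (Re q - x) > 0" "R + (Re q - x) > 0" using R0 by (auto simp: zero_less_mult_iff)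
  qed
  have Y: "Y q > 0" "moeb M (of_real (Y q) * \<i>) = q" "(Y q)\<^sup>2 = (R + (Re q - x)) / (R - (Re q - x))"
    if q: "q \<in> uhp" "cmod (q - of_real x) = R" for q
  proof -
    note c = circ[OF q]
    show "Y q > 0" using c q(1) by (simp add: Y_def uhp_def)
    show "(Y q)\<^sup>2 = (R + (Re q - x)) / (R - (Re q - x))"
      unfolding Y_def power_divide c(3) using c(1) by (simp add: power2_eq_square)
    have s: "complex_of_real (sqrt (2*R)) \<noteq> 0" using R0 by simp
    have n: "of_real (Y q) * \<i> + 1 \<noteq> 0" by (simp add: complex_eq_iff)
    have "moeb M (of_real (Y q) * \<i>) = (of_real (x+R) * (of_real (Y q) * \<i>) + of_real (x-R)) / (of_real (Y q) * \<i> + 1)"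
      using s n by (simp add: moeb_def M_def add_divide_distrib[symmetric] diff_divide_distrib[symmetric])
    also have "of_real (x+R) * (of_real (Y q) * \<i>) + of_real (x-R) = q * (of_real (Y q) * \<i> + 1)"
    proof -
      have "Im q * Y q = R + (Re q - x)" using c unfolding Y_def by (simp add: power2_eq_square[symmetric])
      moreover have "(R - (Re q - x)) * Y q = Im q" using c by (simp add: Y_def)
      ultimately show ?thesis by (simp add: complex_eq_iff algebra_simps)
    qed
    finally show "moeb M (of_real (Y q) * \<i>) = q" using n by simp
  qed
  have mono: "Y q \<le> Y q'" if q: "q \<in> uhp" "cmod (q - of_real x) = R" and q': "q' \<in> uhp" "cmod (q' - of_real x) = R"
    and "Re q \<le> Re q'" for q q'
  proof -
    have "(Y q)\<^sup>2 \<le> (Y q')\<^sup>2"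
      unfolding Y(3)[OF q] Y(3)[OF q'] using circ(1,2)[OF q] circ(1,2)[OF q'] that(5) by - (rule frac_le, linarith+)
    then show ?thesis using Y(1)[OF q'] by - (rule power2_le_imp_le, simp_all)
  qed
  have le': "Y z \<le> Y p" "Y p \<le> Y w"
    using mono[OF u(1) R(1) u(2) R(2) le(1)] mono[OF u(2) R(2) u(3) R(3) le(2)] by blast+
  then have "p \<in> (\<lambda>y. moeb M (of_real y * \<i>)) ` {Y z..Y w}"
    using Y(2)[OF u(2) R(2)] by (intro image_eqI[of _ _ "Y p"]) simp_all
  also have "\<dots> = hsegment z w"
    using hsegment_geodesic[OF M Y(1)[OF u(1) R(1)], of "Y w"] le'
    unfolding Y(2)[OF u(1) R(1)] Y(2)[OF u(3) R(3)] by simp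
  finally show ?thesis .
qed

text \<open>
  The circle through \<open>p\<close> and \<open>c\<close> centred on the real axis meets the imaginary axis, beyond \<open>p\<close>,
  as soon as \<open>p\<close> is close to that axis.  The last hypothesis is this condition, with the
  denominator \<open>Re c - Re p\<close> of the centre cleared.  So a convex set that contains \<open>c\<close> and the
  imaginary axis contains \<open>p\<close>.
\<close>
lemma triangle_hsegment:
  assumes c: "c \<in> uhp" and p: "p \<in> uhp" and s: "Re c * Re p > 0" "\<bar>Re p\<bar> < \<bar>Re c\<bar>"
    and pos: "((cmod p)\<^sup>2 * Re c - (cmod c)\<^sup>2 * Re p) * Re c > 0"
  obtains z where "z \<in> imag_axis" "p \<in> hsegment z c"
proof -
  define D where "D = Re c - Re p"
  have D: "D * Re c > 0" using s by (auto simp: D_def abs_if zero_less_mult_iff split: if_splits)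
  then have D0: "D \<noteq> 0" by auto
  define x where "x = ((cmod c)\<^sup>2 - (cmod p)\<^sup>2) / (2 * D)"
  define q where "q = (cmod p)\<^sup>2 - 2 * x * Re p"
  have "q = ((cmod p)\<^sup>2 * Re c - (cmod c)\<^sup>2 * Re p) / D"
    using D0 by (simp add: q_def x_def field_simps D_def)
  then have "q = (((cmod p)\<^sup>2 * Re c - (cmod c)\<^sup>2 * Re p) * Re c) / (D * Re c)" using D by (cases "Re c = 0") auto
  then have q0: "q > 0" using divide_pos_pos[OF pos D] by simp
  define z where "z = of_real (sqrt q) * \<i>"
  have z: "z \<in> imag_axis" "z \<in> uhp" using q0 by (auto simp: z_def imag_axis_def uhp_def)
  have sq: "(cmod (v - of_real x))\<^sup>2 = (cmod v)\<^sup>2 - 2 * x * Re v + x\<^sup>2" for v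
    unfolding cmod_power2 by (simp add: power2_eq_square algebra_simps)
  have "(cmod (z - of_real x))\<^sup>2 = (cmod (p - of_real x))\<^sup>2"
    unfolding sq using q0 by (simp add: z_def norm_mult q_def)
  moreover have "(cmod (c - of_real x))\<^sup>2 = (cmod (p - of_real x))\<^sup>2"
  proof -
    have "2 * x * D = (cmod c)\<^sup>2 - (cmod p)\<^sup>2" using D0 by (simp add: x_def)
    then show ?thesis unfolding sq by (simp add: D_def algebra_simps)
  qed
  ultimately have e: "cmod (z - of_real x) = cmod (p - of_real x)" "cmod (c - of_real x) = cmod (p - of_real x)"
    by simp_all
  have "Re z = 0" by (simp add: z_def)
  then have "p \<in> hsegment z c"
  proof (cases "Re c > 0")
    case True
    then show ?thesis using s \<open>Re z = 0\<close> e by (intro circle_hsegment[OF z(2) p c, of x]) (auto simp: zero_less_mult_iff)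
  next
    case False
    then have "p \<in> hsegment c z"
      using s \<open>Re z = 0\<close> e by (intro circle_hsegment[OF c p z(2), of x]) (auto simp: zero_less_mult_iff)
    then show ?thesis by (simp add: hsegment_commute)
  qed
  then show ?thesis using z that by blast
qed

lemma imag_axis_subset_cover:
  assumes "half_collar l X" shows "imag_axis \<subseteq> cover X"
proof -
  have "is_boundary (deck X) (cover X) (Geodesic imag_axis)" "closedin (top_of_set uhp) (cover X)"
    using assms by (auto simp: half_collar_def geodesic_pants_def hyperbolic_surface_def)
  then have f: "imag_axis \<subseteq> closure (cover X)" by (auto simp: frontier_def)
  obtain T where T: "closed T" "cover X = uhp \<inter> T"
    using \<open>closedin (top_of_set uhp) (cover X)\<close> by (auto simp: closedin_closed)
  then have "closure (cover X) \<subseteq> T" by (simp add: closure_minimal)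
  then show ?thesis using f T by (auto simp: imag_axis_def)
qed

text \<open>
  The cosine of the angle \<open>\<theta>\<close> along the periodic lift of \<open>\<beta>\<close>, as a function of \<open>s = ln |z|\<close>.  For positive \<open>k\<close>
  it is comparable to the width \<open>\<pi>/2 - \<theta>\<close> of the half-collar at \<open>s\<close>, being its sine.
\<close>
definition collar_width :: "real \<Rightarrow> real \<Rightarrow> real \<Rightarrow> real \<Rightarrow> real" where
  "collar_width l k a s = k * cosh (lattice_dist l (s - a))"

lemma continuous_collar_width: "l > 0 \<Longrightarrow> continuous_on A (collar_width l k a)"
  unfolding collar_width_def
  by (intro continuous_intros continuous_on_compose2[OF continuous_lattice_dist[of l UNIV]]) auto

lemma open_uhp: "open uhp"
  unfolding uhp_def by (intro open_Collect_less continuous_intros)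

text \<open>
  The lift of \<open>\<beta>\<close> is the zero set of a continuous function \<open>g\<close> on the half-plane that is negative on the
  imaginary axis; on the component of its complement that contains this axis \<open>g\<close> stays negative,
  and on the cover this bounds \<open>|Re z|\<close>.  The open set in the second part guarantees that the
  annulus has positive area.  It consists of points near \<open>exp (l/2) \<i>\<close>, which belong to the convex cover
  because they lie on segments from \<open>cross X\<close> to the axis.
\<close>
lemma half_collar_lift_shape:
  assumes l: "l > 0" and hc: "half_collar l X" and f: "foot1 X \<in> imag_axis" and k0: "k \<noteq> 0"
    and beta: "beta_lift l X = {p \<in> uhp. Re p = cmod p * collar_width l k a (ln (cmod p))}"
    and cr: "cross X \<in> uhp" "Re (cross X) * k > 0"
    and side: "\<And>z. z \<in> cover X \<Longrightarrow> k * Re z \<ge> 0"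
  shows "half_collar_lift l X \<subseteq> {z \<in> uhp. \<bar>Re z\<bar> \<le> cmod z * collar_width l \<bar>k\<bar> a (ln (cmod z))}"
    and "\<exists>U. open U \<and> U \<noteq> {} \<and> U \<subseteq> half_collar_lift l X \<inter> {z. 1 < cmod z \<and> cmod z < exp l}"
proof -
  define C where "C = connected_component_set (uhp - beta_lift l X) (foot1 X)"
  define g where "g z = k * Re z - cmod z * collar_width l (k\<^sup>2) a (ln (cmod z))" for z
  have cw: "collar_width l (k\<^sup>2) a s = k * collar_width l k a s" for s by (simp add: collar_width_def power2_eq_square)
  have gb: "beta_lift l X = {z \<in> uhp. g z = 0}" unfolding beta g_def cw using k0 by (auto simp: algebra_simps)
  have contg: "continuous_on uhp g"
    unfolding g_def using l
    by (intro continuous_intros continuous_on_compose2[OF continuous_collar_width[of l UNIV]]) (auto simp: uhp_def)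
  have gneg: "g z < 0" if "z \<in> imag_axis" for z
    using that k0 by (auto simp: imag_axis_def uhp_def g_def collar_width_def intro!: mult_pos_pos)
  have "connected imag_axis" unfolding imag_axis_param
    by (intro connected_continuous_image continuous_intros) auto
  then have axC: "imag_axis \<subseteq> C"
    unfolding C_def
  proof (intro connected_component_maximal f)
    show "imag_axis \<subseteq> uhp - beta_lift l X"
    proof
      fix z assume "z \<in> imag_axis"
      then show "z \<in> uhp - beta_lift l X" using gneg[of z] by (simp add: gb imag_axis_def)
    qed
  qed
  have "connected C" by (simp add: C_def)
  have CU: "C \<subseteq> uhp - beta_lift l X" unfolding C_def by (rule connected_component_subset)
  have Cneg: "g z < 0" if "z \<in> C" for z
  proof (rule ccontr)
    assume "\<not> g z < 0"
    moreover have "connected (g ` C)" using \<open>connected C\<close> CU contg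
      by (intro connected_continuous_image continuous_on_subset[OF contg]) auto
    ultimately have "0 \<in> g ` C" using that axC f gneg[OF f]
      using connectedD_interval[of "g ` C" "g (foot1 X)" "g z" 0] by auto
    then show False using CU gb by auto
  qed
  show "half_collar_lift l X \<subseteq> {z \<in> uhp. \<bar>Re z\<bar> \<le> cmod z * collar_width l \<bar>k\<bar> a (ln (cmod z))}"
  proof
    fix z assume "z \<in> half_collar_lift l X"
    then have z: "z \<in> cover X" "z \<in> C" by (auto simp: half_collar_lift_def C_def)
    have "\<bar>k\<bar> * \<bar>Re z\<bar> = k * Re z" using side[OF z(1)] by (simp flip: abs_mult)
    also have "\<dots> \<le> cmod z * collar_width l (k\<^sup>2) a (ln (cmod z))" using Cneg[OF z(2)] by (simp add: g_def)
    also have "\<dots> = \<bar>k\<bar> * (cmod z * collar_width l \<bar>k\<bar> a (ln (cmod z)))"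
      by (simp add: collar_width_def power2_eq_square)
    finally show "z \<in> {z \<in> uhp. \<bar>Re z\<bar> \<le> cmod z * collar_width l \<bar>k\<bar> a (ln (cmod z))}" using k0 z CU by auto
  qed
  have "open (uhp - beta_lift l X)"
  proof -
    have "uhp - beta_lift l X = uhp \<inter> g -` (- {0})" by (auto simp: gb)
    then show ?thesis using continuous_open_preimage[OF contg open_uhp, of "- {0}"] by (simp add: open_Compl)
  qed
  then have oC: "open C" unfolding C_def by (rule open_connected_component)
  define c where "c = cross X"
  define q where "q = of_real (exp (l/2)) * \<i>"
  define V where "V = C \<inter> {z. 1 < cmod z} \<inter> {z. cmod z < exp l} \<inter> {z. \<bar>Re z\<bar> < \<bar>Re c\<bar>}
     \<inter> {z. ((cmod z)\<^sup>2 * Re c - (cmod c)\<^sup>2 * Re z) * Re c > 0}"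
  have c0: "Re c \<noteq> 0" using cr by (auto simp: c_def)
  have oV: "open V" unfolding V_def
    by (intro open_Int oC open_Collect_less continuous_intros)
  have "q \<in> imag_axis" by (simp add: q_def imag_axis_def uhp_def)
  have nq: "cmod q = exp (l/2)" "Re q = 0" by (simp_all add: q_def norm_mult)
  have "q \<in> C" using axC \<open>q \<in> imag_axis\<close> by blast
  moreover have "((cmod q)\<^sup>2 * Re c - (cmod c)\<^sup>2 * Re q) * Re c > 0"
  proof -
    have "((cmod q)\<^sup>2 * Re c - (cmod c)\<^sup>2 * Re q) * Re c = (exp (l/2) * Re c)\<^sup>2"
      by (simp add: nq power2_eq_square)
    then show ?thesis using c0 by simp
  qed
  ultimately have qV: "q \<in> V" using l c0 by (simp add: V_def nq)
  then obtain e where e: "e > 0" "ball q e \<subseteq> V" using oV open_contains_ball by blast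
  define U where "U = V \<inter> {z. Re c * Re z > 0}"
  have oU: "open U" unfolding U_def by (intro open_Int oV open_Collect_less continuous_intros)
  define p where "p = q + of_real (sgn (Re c) * (e/2))"
  have "dist q p = e / 2"
  proof -
    have "q - p = of_real (- (sgn (Re c) * (e/2)))" by (simp add: p_def)
    then show ?thesis unfolding dist_norm using e(1) c0 by (simp only: norm_of_real) (simp add: abs_mult abs_sgn_eq)
  qed
  then have "p \<in> V" using e by auto
  moreover have "Re c * Re p = \<bar>Re c\<bar> * (e/2)" by (simp add: p_def nq abs_sgn)
  moreover have "\<bar>Re c\<bar> * (e/2) > 0" using e(1) c0 by simp
  ultimately have "p \<in> U" unfolding U_def by simp
  moreover have "U \<subseteq> cover X"
  proof
    fix p assume p: "p \<in> U"
    then have "p \<in> uhp" using CU by (auto simp: U_def V_def)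
    then obtain z where z: "z \<in> imag_axis" "p \<in> hsegment z c"
      using triangle_hsegment[of c p] p cr by (auto simp: U_def V_def c_def)
    have "\<forall>z\<in>cover X. \<forall>w\<in>cover X. hsegment z w \<subseteq> cover X" "cross X \<in> cover X"
      using hc by (auto simp: half_collar_def geodesic_pants_def hyperbolic_surface_def)
    then show "p \<in> cover X" using z imag_axis_subset_cover[OF hc] by (auto simp: c_def)
  qed
  ultimately show "\<exists>U. open U \<and> U \<noteq> {} \<and> U \<subseteq> half_collar_lift l X \<inter> {z. 1 < cmod z \<and> cmod z < exp l}"
    using oU by (intro exI[of _ U]) (auto simp: U_def V_def half_collar_lift_def C_def)
qed

text \<open>
  The angle of \<open>c\<close> satisfies \<open>cos \<theta> = k\<close>, so \<open>|k| = tanh \<ell>(\<eta>)\<close>.  Consequently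
  \<open>cosh r(\<ell>(\<eta>)) = 1 / |k|\<close>.
\<close>
lemma exp_r_fun_ge:
  assumes c: "c \<in> uhp" "cmod c = r" "Re c = r * k" and r: "r > 0" and k: "k \<noteq> 0"
  shows "exp (r_fun (hdist (of_real r * \<i>) c)) \<ge> 1 / \<bar>k\<bar>"
proof -
  define h where "h = sqrt (1 - k\<^sup>2)"
  have ic: "Im c > 0" using c by (simp add: uhp_def)
  have "(Im c)\<^sup>2 = r\<^sup>2 * (1 - k\<^sup>2)" using cmod_power2[of c] c by (simp add: algebra_simps power2_eq_square)
  then have "sqrt ((Im c)\<^sup>2) = sqrt (r\<^sup>2 * (1 - k\<^sup>2))" by simp
  then have imc: "Im c = r * h" using ic r by (simp add: real_sqrt_mult h_def)
  have h: "h > 0" "h\<^sup>2 = 1 - k\<^sup>2"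
  proof -
    show h0: "h > 0" using ic r imc by (simp add: zero_less_mult_iff)
    show "h\<^sup>2 = 1 - k\<^sup>2" using h0 unfolding h_def by (metis less_eq_real_def real_sqrt_gt_0_iff real_sqrt_pow2)
  qed
  have ru: "of_real r * \<i> \<in> uhp" using r by (simp add: uhp_def)
  define d where "d = hdist (of_real r * \<i>) c"
  have d0: "d \<ge> 0" unfolding d_def by (rule cosh_hdist(2)[OF ru c(1)])
  have "(cmod (of_real r * \<i> - c))\<^sup>2 = (r * k)\<^sup>2 + (r - r * h)\<^sup>2" by (simp add: cmod_power2 c imc)
  also have "\<dots> = r\<^sup>2 * (2 - 2 * h)"
  proof -
    have k2: "k\<^sup>2 = 1 - h\<^sup>2" using h(2) by simp
    show ?thesis unfolding power_mult_distrib k2 by (simp add: power2_eq_square algebra_simps)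
  qed
  finally have n: "(cmod (of_real r * \<i> - c))\<^sup>2 = r\<^sup>2 * (2 - 2 * h)" .
  have ch: "cosh d = 1 / h"
    unfolding d_def cosh_hdist(1)[OF ru c(1)] n using r h by (simp add: imc field_simps power2_eq_square)
  have "(sinh d)\<^sup>2 = 1 / h\<^sup>2 - 1" using cosh_square_eq[of d] by (simp add: ch power_divide)
  also have "\<dots> = (1 - h\<^sup>2) / h\<^sup>2" using h(1) by (simp add: diff_divide_distrib)
  also have "\<dots> = (k / h)\<^sup>2" by (simp add: h(2) power_divide)
  finally have "(sinh d)\<^sup>2 = (k / h)\<^sup>2" .
  then have "(sinh d)\<^sup>2 = (\<bar>k\<bar> / h)\<^sup>2" by (simp add: power_divide)
  then have sd: "sinh d = \<bar>k\<bar> / h" using d0 h by - (rule power2_eq_imp_eq, auto)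
  define x where "x = 1 / sinh d"
  have "x\<^sup>2 + 1 = (h\<^sup>2 + k\<^sup>2) / k\<^sup>2" unfolding x_def sd using k by (simp add: power_divide add_divide_distrib)
  then have "x\<^sup>2 + 1 = (1 / k)\<^sup>2" by (simp add: h(2) power_divide)
  then have "sqrt (x\<^sup>2 + 1) = 1 / \<bar>k\<bar>" by (simp add: real_sqrt_divide)
  moreover have "exp (arsinh x) = x + sqrt (x\<^sup>2 + 1)"
    unfolding arsinh_real_def by (rule exp_ln) (rule arsinh_real_aux)
  moreover have "x \<ge> 0" using sd h by (simp add: x_def)
  ultimately show ?thesis by (simp add: r_fun_def x_def d_def)
qed

section \<open>Length and area in a metric adapted to the width\<close>

text \<open>
  A simple function below \<open>r f\<close> is \<open>r\<close> times a simple function below \<open>f\<close>.  In this form the rule applies to the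
  integrand of a curve length without a proof that it is measurable.
\<close>
lemma nn_integral_scale_le:
  assumes r: "r > 0"
  shows "(\<integral>\<^sup>+ x. ennreal r * f x \<partial>M) \<le> ennreal r * (\<integral>\<^sup>+ x. f x \<partial>M)"
  unfolding nn_integral_def[of M "\<lambda>x. ennreal r * f x"]
proof (rule SUP_least, clarify)
  fix g assume g: "simple_function M g" and le: "g \<le> (\<lambda>x. ennreal r * f x)"
  have inv: "ennreal r * ennreal (1/r) = 1" using r by (simp flip: ennreal_mult)
  have gm: "(\<lambda>x. ennreal (1/r) * g x) \<in> borel_measurable M"
    using borel_measurable_simple_function[OF g] by simp
  have "integral\<^sup>S M g = (\<integral>\<^sup>+ x. ennreal r * (ennreal (1/r) * g x) \<partial>M)"
    using g by (simp add: nn_integral_eq_simple_integral inv flip: mult.assoc)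
  also have "\<dots> = ennreal r * (\<integral>\<^sup>+ x. ennreal (1/r) * g x \<partial>M)"
    using gm by (rule nn_integral_cmult)
  also have "\<dots> \<le> ennreal r * (\<integral>\<^sup>+ x. f x \<partial>M)"
  proof (intro mult_left_mono nn_integral_mono)
    fix x
    have "ennreal (1/r) * g x \<le> ennreal (1/r) * (ennreal r * f x)" using le by (intro mult_left_mono) (auto simp: le_fun_def)
    also have "\<dots> = f x" using inv by (simp add: mult.commute flip: mult.assoc)
    finally show "ennreal (1/r) * g x \<le> f x" .
  qed simp
  finally show "integral\<^sup>S M g \<le> ennreal r * (\<integral>\<^sup>+ x. f x \<partial>M)" .
qed

text \<open>
  When the right-hand side is finite, the gauge integrable function is Lebesgue integrable.
\<close>
lemma norm_has_integral_le_nn_integral: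
  fixes f' :: "real \<Rightarrow> complex"
  assumes f: "(f' has_integral y) S" and g: "\<And>t. t \<in> S \<Longrightarrow> norm (f' t) \<le> g t"
  shows "ennreal (norm y) \<le> (\<integral>\<^sup>+ t\<in>S. ennreal (g t) \<partial>lborel)"
proof -
  define h where "h t = indicator S t *\<^sub>R f' t" for t
  have m: "h \<in> borel_measurable lebesgue"
    unfolding h_def by (rule has_integral_implies_lebesgue_measurable[OF f])
  have n: "(\<integral>\<^sup>+ t. ennreal (norm (h t)) \<partial>lebesgue) \<le> (\<integral>\<^sup>+ t\<in>S. ennreal (g t) \<partial>lborel)"
    unfolding nn_integral_completion using g by (intro nn_integral_mono) (auto simp: h_def indicator_def intro!: ennreal_leI)
  show ?thesis
  proof (cases "(\<integral>\<^sup>+ t\<in>S. ennreal (g t) \<partial>lborel) = \<infinity>")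
    case False
    then have "integrable lebesgue h" using m n by (intro integrableI_bounded) (auto simp: top.not_eq_extremum intro: le_less_trans)
    then have si: "set_integrable lebesgue S f'" by (simp add: set_integrable_def h_def[abs_def])
    have "integral\<^sup>L lebesgue h = y"
      using set_lebesgue_integral_eq_integral(2)[OF si] integral_unique[OF f] by (simp add: set_lebesgue_integral_def h_def[abs_def])
    then have "ennreal (norm y) \<le> (\<integral>\<^sup>+ t. ennreal (norm (h t)) \<partial>lebesgue)"
      using integral_norm_bound_ennreal[OF \<open>integrable lebesgue h\<close>] by simp
    then show ?thesis using n by (rule order_trans)
  qed simp
qed

text \<open>
  The derivative of \<open>Ln (c t)\<close> is \<open>c' t / c t\<close>.  A piecewise \<open>C\<^sup>1\<close> curve may have an unbounded
  derivative near its finitely many exceptional points, so the gauge integral is used for the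
  fundamental theorem of calculus.
\<close>
lemma Ln_increment_le:
  assumes c: "c piecewise_C1_differentiable_on {0..1}" and u: "\<And>t. t \<in> {0..1} \<Longrightarrow> c t \<in> uhp" and T: "T \<in> {0..1}"
  shows "ennreal (cmod (Ln (c T) - Ln (c 0))) \<le>
    (\<integral>\<^sup>+ t\<in>{0..1}. ennreal (norm (vector_derivative c (at t)) / cmod (c t)) \<partial>lborel)"
proof -
  obtain S where S: "finite S" "c C1_differentiable_on ({0..1} - S)" and cont: "continuous_on {0..1} c"
    using c by (auto simp: piecewise_C1_differentiable_on_def)
  have dc: "(c has_vector_derivative vector_derivative c (at t)) (at t)" if "t \<in> {0..1} - S" for t
    using S(2) that unfolding C1_differentiable_on_def by (metis vector_derivative_at)
  have np: "c t \<notin> \<real>\<^sub>\<le>\<^sub>0" if "t \<in> {0..1}" for t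
    using u[OF that] by (auto simp: uhp_def complex_nonpos_Reals_iff)
  have "((\<lambda>t. vector_derivative c (at t) * inverse (c t)) has_integral (Ln \<circ> c) T - (Ln \<circ> c) 0) {0..T}"
  proof (rule fundamental_theorem_of_calculus_interior_strong[OF S(1)])
    show "0 \<le> T" using T by simp
    show "continuous_on {0..T} (Ln \<circ> c)"
      using np T continuous_on_subset[OF cont, of "{0..T}"] by (auto simp: o_def intro!: continuous_intros)
    fix t assume "t \<in> {0<..<T} - S"
    then have t: "t \<in> {0..1} - S" using T by auto
    show "((Ln \<circ> c) has_vector_derivative vector_derivative c (at t) * inverse (c t)) (at t)"
      using np[of t] t by (intro field_vector_diff_chain_at dc has_field_derivative_Ln) auto
  qed
  from norm_has_integral_le_nn_integral[OF this order_refl]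
  have "ennreal (cmod (Ln (c T) - Ln (c 0))) \<le>
    (\<integral>\<^sup>+ t\<in>{0..T}. ennreal (norm (vector_derivative c (at t) * inverse (c t))) \<partial>lborel)" by simp
  also have "\<dots> \<le> (\<integral>\<^sup>+ t\<in>{0..1}. ennreal (norm (vector_derivative c (at t)) / cmod (c t)) \<partial>lborel)"
    using T by (intro nn_integral_mono) (auto simp: indicator_def norm_mult norm_inverse divide_inverse)
  finally show ?thesis .
qed

lemma cos_arg_increment_le:
  assumes "z \<in> uhp" "w \<in> uhp"
  shows "\<bar>Re z / cmod z - Re w / cmod w\<bar> \<le> cmod (Ln z - Ln w)"
proof -
  have e: "Re v / cmod v = cos (Im (Ln v))" if "v \<in> uhp" for v
  proof -
    have "v \<noteq> 0" using that by (auto simp: uhp_def)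
    then have "Re v = cmod v * cos (Im (Ln v))" using Re_exp[of "Ln v"] by simp
    then show ?thesis using \<open>v \<noteq> 0\<close> by simp
  qed
  define p q where "p = Im (Ln z)" and "q = Im (Ln w)"
  have "\<bar>cos p - cos q\<bar> = 2 * \<bar>sin ((p + q) / 2)\<bar> * \<bar>sin ((q - p) / 2)\<bar>"
    by (simp add: cos_diff_cos abs_mult)
  also have "\<dots> \<le> 2 * 1 * \<bar>(q - p) / 2\<bar>"
    by (intro mult_mono abs_sin_x_le_abs_x) auto
  also have "\<dots> = \<bar>Im (Ln z - Ln w)\<bar>" by (simp add: p_def q_def abs_minus_commute)
  also have "\<dots> \<le> cmod (Ln z - Ln w)" by (rule abs_Im_le_cmod)
  finally show ?thesis using e assms by (simp add: p_def q_def)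
qed

text \<open>
  The metric \<open>|dz| / (|z| F(ln |z|))\<close> is the Euclidean metric in the coordinate \<open>log z\<close>, divided at each place
  by the width \<open>F\<close>.
\<close>
definition width_metric :: "(real \<Rightarrow> real) \<Rightarrow> complex \<Rightarrow> ennreal" where
  "width_metric F z = ennreal (1 / (cmod z * F (ln (cmod z))))"

text \<open>
  Suppose the length is \<open>x < 1/8\<close>.  Since \<open>F \<le> 2\<close>, the coordinate \<open>s = ln |z|\<close> changes by at most \<open>2x\<close>
  along the curve, so \<open>f1\<close> and \<open>f2\<close> change at most by the factor \<open>exp (2x)\<close>.  With \<open>F\<close> taken at the starting
  point, the curve therefore moves by at most \<open>exp (2x) F x\<close> in the coordinate \<open>log z\<close>, whereas the values of
  \<open>cos \<theta>\<close> at its endpoints differ by at least \<open>exp (- 2x) F\<close>.  Hence \<open>exp (- 4x) \<le> x\<close>, which is impossible for \<open>x < 1/8\<close>.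
\<close>
lemma width_metric_length_ge:
  assumes pos: "\<And>s. f1 s > 0" "\<And>s. f2 s > 0" and le2: "\<And>s. f1 s + f2 s \<le> 2"
    and lip: "\<And>s s'. f1 s \<le> exp \<bar>s - s'\<bar> * f1 s'" "\<And>s s'. f2 s \<le> exp \<bar>s - s'\<bar> * f2 s'"
    and c: "c piecewise_C1_differentiable_on {0..1}" and u: "\<And>t. t \<in> {0..1} \<Longrightarrow> c t \<in> uhp"
    and ends: "f1 (ln (cmod (c 0))) + f2 (ln (cmod (c 1))) \<le> \<bar>Re (c 0) / cmod (c 0) - Re (c 1) / cmod (c 1)\<bar>"
  shows "metric_length (width_metric (\<lambda>s. f1 s + f2 s)) c \<ge> ennreal (1/8)"
proof (rule ccontr)
  define F where "F s = f1 s + f2 s" for s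
  define s where "s t = ln (cmod (c t))" for t
  define L where "L = metric_length (width_metric F) c"
  define W where "W = (\<integral>\<^sup>+ t\<in>{0..1}. ennreal (norm (vector_derivative c (at t)) / cmod (c t)) \<partial>lborel)"
  assume "\<not> metric_length (width_metric (\<lambda>s. f1 s + f2 s)) c \<ge> ennreal (1/8)"
  then have "L < ennreal (1/8)" by (simp add: L_def F_def[abs_def])
  then obtain x where x: "L = ennreal x" "0 \<le> x" "x < 1/8"
    by (cases L) (auto simp: ennreal_less_iff)
  have F0: "F v > 0" for v using pos[of v] by (simp add: F_def)
  have W_le: "W \<le> ennreal (B * x)" if B: "B > 0" "\<And>t. t \<in> {0..1} \<Longrightarrow> F (s t) \<le> B" for B
  proof -
    have "W \<le> (\<integral>\<^sup>+ t. ennreal B * (width_metric F (c t) * ennreal (norm (vector_derivative c (at t))) * indicator {0..1} t) \<partial>lborel)"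
      unfolding W_def
    proof (intro nn_integral_mono)
      fix t :: real
      show "ennreal (norm (vector_derivative c (at t)) / cmod (c t)) * indicator {0..1} t \<le>
        ennreal B * (width_metric F (c t) * ennreal (norm (vector_derivative c (at t))) * indicator {0..1} t)"
      proof (cases "t \<in> {0..1}")
        case True
        have n: "cmod (c t) > 0" using u[OF True] by (auto simp: uhp_def)
        have "norm (vector_derivative c (at t)) / cmod (c t) \<le> B * (1 / (cmod (c t) * F (s t)) * norm (vector_derivative c (at t)))"
          using n F0[of "s t"] B(2)[OF True] by (simp add: field_simps mult_right_mono)
        then show ?thesis using True n B(1) F0[of "s t"]
          by (simp add: width_metric_def s_def[symmetric] ennreal_mult[symmetric])
      qed simp
    qed
    also have "\<dots> \<le> ennreal B * L" unfolding L_def metric_length_def by (rule nn_integral_scale_le[OF B(1)])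
    also have "\<dots> = ennreal (B * x)" using x B by (simp add: ennreal_mult)
    finally show ?thesis .
  qed
  have inc: "cmod (Ln (c t) - Ln (c 0)) \<le> B * x" if "B > 0" "\<And>t. t \<in> {0..1} \<Longrightarrow> F (s t) \<le> B" "t \<in> {0..1}" for B t
    using order_trans[OF Ln_increment_le[OF c u that(3)] W_le[OF that(1,2), unfolded W_def]] that(1) x
    by (simp add: ennreal_le_iff)
  have s_near: "\<bar>s t - s 0\<bar> \<le> 2 * x" if "t \<in> {0..1}" for t
  proof -
    have ne: "c t \<noteq> 0" "c 0 \<noteq> 0" using u[OF that] u[of 0] by (auto simp: uhp_def)
    have "\<bar>Re (Ln (c t) - Ln (c 0))\<bar> \<le> 2 * x"
      using inc[of 2 t] le2 that abs_Re_le_cmod[of "Ln (c t) - Ln (c 0)"] unfolding F_def by fastforce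
    then show ?thesis using ne by (simp add: s_def)
  qed
  have F_near: "F (s t) \<le> exp (2 * x) * F (s 0)" if "t \<in> {0..1}" for t
  proof -
    have "F (s t) \<le> exp \<bar>s t - s 0\<bar> * F (s 0)" using lip[of "s t" "s 0"] by (simp add: F_def distrib_left)
    also have "\<dots> \<le> exp (2 * x) * F (s 0)" using s_near[OF that] F0[of "s 0"] by (intro mult_right_mono) auto
    finally show ?thesis .
  qed
  have "f1 (s 0) + f2 (s 1) \<le> cmod (Ln (c 0) - Ln (c 1))"
    using ends cos_arg_increment_le[of "c 0" "c 1"] u unfolding s_def by fastforce
  also have "\<dots> \<le> exp (2 * x) * F (s 0) * x"
    using inc[of "exp (2 * x) * F (s 0)" 1] F_near F0[of "s 0"] by (simp add: norm_minus_commute)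
  finally have up: "f1 (s 0) + f2 (s 1) \<le> exp (2 * x) * F (s 0) * x" .
  have "F (s 0) \<le> exp (2 * x) * (f1 (s 0) + f2 (s 1))"
  proof -
    have "f2 (s 0) \<le> exp \<bar>s 0 - s 1\<bar> * f2 (s 1)" by (rule lip(2))
    also have "\<dots> \<le> exp (2 * x) * f2 (s 1)" using s_near[of 1] pos(2)[of "s 1"] by (intro mult_right_mono) (auto simp: abs_minus_commute)
    finally have "f2 (s 0) \<le> exp (2 * x) * f2 (s 1)" .
    moreover have "1 * f1 (s 0) \<le> exp (2 * x) * f1 (s 0)" using x pos(1)[of "s 0"] by (intro mult_right_mono) auto
    ultimately show ?thesis by (simp add: F_def distrib_left)
  qed
  also have "\<dots> \<le> exp (2 * x) * (exp (2 * x) * F (s 0) * x)" using up by simp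
  also have "\<dots> = (exp (4 * x) * x) * F (s 0)" by (simp flip: exp_add)
  finally have "1 \<le> exp (4 * x) * x" using F0[of "s 0"] by simp
  then have "exp (- (4 * x)) \<le> x" by (simp add: exp_minus field_simps)
  then show False using exp_ge_add_one_self[of "- (4 * x)"] x by linarith
qed

text \<open>
  On the part \<open>k \<le> ln |z| \<le> k + 1\<close> the width \<open>F\<close> equals \<open>F k\<close> up to a factor \<open>e\<close>.  So this part of \<open>R\<close> lies in the
  rectangle \<open>Q k\<close> of area \<open>2 exp (2k + 3) F k\<close>, and on it the square of the metric is at most \<open>K k\<close>.
\<close>
lemma width_metric_area_le:
  assumes pos: "\<And>s. F s > 0" and lip: "\<And>s s'. F s \<le> exp \<bar>s - s'\<bar> * F s'"
    and R: "R \<subseteq> {z \<in> uhp. \<bar>Re z\<bar> \<le> cmod z * F (ln (cmod z))}"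
  shows "metric_area l R (width_metric F) \<le> ennreal (\<Sum>k<nat \<lceil>l\<rceil>. 2 * exp 5 / F (real k))"
proof -
  define n where "n = nat \<lceil>l\<rceil>"
  define K where "K k = (exp (1 - real k) / F (real k))\<^sup>2" for k
  define w where "w k = exp (real k + 2) * F (real k)" for k
  define Q where "Q k = cbox (Complex (- w k) 0) (Complex (w k) (exp (real k + 1)))" for k
  have near: "\<bar>Re z\<bar> \<le> w k" "1 / (cmod z * F (ln (cmod z))) \<le> exp (1 - real k) / F (real k)"
    if z: "z \<in> uhp" "\<bar>Re z\<bar> \<le> cmod z * F (ln (cmod z))" and k: "real k \<le> ln (cmod z)" "ln (cmod z) \<le> real k + 1" for z k
  proof -
    have n: "cmod z > 0" using z by (auto simp: uhp_def)
    have zle: "exp (real k) \<le> cmod z" "cmod z \<le> exp (real k + 1)"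
    proof -
      show "exp (real k) \<le> cmod z" "cmod z \<le> exp (real k + 1)"
        using k exp_ln[OF n] by (metis exp_le_cancel_iff)+
    qed
    have e: "exp \<bar>u - v\<bar> * F v \<le> exp 1 * F v" if "\<bar>u - v\<bar> \<le> 1" for u v using that pos[of v] by simp
    have F1: "F (ln (cmod z)) \<le> exp 1 * F (real k)"
      using order_trans[OF lip e, of "ln (cmod z)" "real k"] k by simp
    have F2: "F (real k) \<le> exp 1 * F (ln (cmod z))"
      using order_trans[OF lip e, of "real k" "ln (cmod z)"] k by simp
    have "\<bar>Re z\<bar> \<le> exp (real k + 1) * (exp 1 * F (real k))"
      using z(2) zle F1 pos[of "ln (cmod z)"] by (smt (verit) mult_mono exp_ge_zero)
    also have "\<dots> = w k" by (simp add: w_def flip: mult.assoc exp_add)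
    finally show "\<bar>Re z\<bar> \<le> w k" .
    have "1 / (cmod z * F (ln (cmod z))) \<le> 1 / (exp (real k) * (F (real k) / exp 1))"
      using zle F2 pos[of "real k"] pos[of "ln (cmod z)"] n
      by (intro divide_left_mono mult_mono mult_pos_pos) (auto simp: divide_le_eq mult.commute)
    also have "\<dots> = exp (1 - real k) / F (real k)" by (simp add: exp_diff)
    finally show "1 / (cmod z * F (ln (cmod z))) \<le> exp (1 - real k) / F (real k)" .
  qed
  have "metric_area l R (width_metric F) \<le> (\<integral>\<^sup>+ z. (\<Sum>k<n. ennreal (K k) * indicator (Q k) z) \<partial>lborel)"
    unfolding metric_area_def
  proof (intro nn_integral_mono)
    fix z :: complex
    show "(width_metric F z)\<^sup>2 * indicator (R \<inter> {z. 1 \<le> cmod z \<and> cmod z < exp l}) z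
       \<le> (\<Sum>k<n. ennreal (K k) * indicator (Q k) z)"
    proof (cases "z \<in> R \<inter> {z. 1 \<le> cmod z \<and> cmod z < exp l}")
      case True
      then have z: "z \<in> uhp" "\<bar>Re z\<bar> \<le> cmod z * F (ln (cmod z))" and zn: "1 \<le> cmod z" "cmod z < exp l" using R by auto
      have ln0: "0 \<le> ln (cmod z)" "ln (cmod z) < l"
      proof -
        show "0 \<le> ln (cmod z)" using zn by simp
        have "ln (cmod z) < ln (exp l)" using zn by (subst ln_less_cancel_iff) linarith+
        then show "ln (cmod z) < l" by simp
      qed
      define k where "k = nat \<lfloor>ln (cmod z)\<rfloor>"
      have k: "real k \<le> ln (cmod z)" "ln (cmod z) \<le> real k + 1" using ln0 unfolding k_def by linarith+
      have kn: "k < n" using ln0 unfolding k_def n_def by linarith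
      have "Im z \<le> exp (real k + 1)"
      proof -
        have "cmod z = exp (ln (cmod z))" using zn by (subst exp_ln) linarith+
        also have "\<dots> \<le> exp (real k + 1)" using k by simp
        finally show ?thesis using abs_Im_le_cmod[of z] by linarith
      qed
      then have "z \<in> Q k" using near(1)[OF z k] z(1) by (auto simp: Q_def in_cbox_complex_iff uhp_def abs_le_iff)
      have "(width_metric F z)\<^sup>2 = ennreal ((1 / (cmod z * F (ln (cmod z))))\<^sup>2)"
        unfolding width_metric_def using pos[of "ln (cmod z)"] by (simp add: ennreal_power)
      also have "\<dots> \<le> ennreal (K k) * indicator (Q k) z"
        using near(2)[OF z k] pos[of "ln (cmod z)"] \<open>z \<in> Q k\<close> unfolding K_def
        by (auto intro!: ennreal_leI power_mono)
      also have "\<dots> \<le> (\<Sum>k<n. ennreal (K k) * indicator (Q k) z)"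
        using kn by (intro member_le_sum) auto
      finally show ?thesis using True by simp
    qed simp
  qed
  also have "\<dots> = (\<Sum>k<n. ennreal (K k) * emeasure lborel (Q k))"
    by (subst nn_integral_sum) (auto simp: Q_def nn_integral_cmult_indicator)
  also have "\<dots> = (\<Sum>k<n. ennreal (2 * exp 5 / F (real k)))"
  proof (intro sum.cong refl)
    fix k
    have w0: "w k > 0" using pos by (simp add: w_def)
    have "emeasure lborel (Q k) = ennreal (2 * w k * exp (real k + 1))"
      unfolding Q_def emeasure_lborel_cbox_eq using w0 by (simp add: Basis_complex_def inner_complex_def)
    then have "ennreal (K k) * emeasure lborel (Q k) = ennreal (K k * (2 * w k * exp (real k + 1)))"
      using w0 by (simp add: K_def ennreal_mult)
    also have "K k * (2 * w k * exp (real k + 1)) = 2 * (exp (1 - real k) * exp (1 - real k) * exp (real k + 2) * exp (real k + 1)) / F (real k)"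
      using pos[of "real k"] by (simp add: K_def w_def power2_eq_square field_simps)
    also have "exp (1 - real k) * exp (1 - real k) * exp (real k + 2) * exp (real k + 1) = exp 5"
      by (simp flip: exp_add)
    finally show "ennreal (K k) * emeasure lborel (Q k) = ennreal (2 * exp 5 / F (real k))" .
  qed
  also have "\<dots> = ennreal (\<Sum>k<n. 2 * exp 5 / F (real k))"
    using pos by (intro sum_ennreal) (simp add: less_imp_le)
  finally show ?thesis unfolding n_def .
qed

section \<open>Widths growing away from two lattices\<close>

text \<open>
  The summand is dominated by an increment of the bounded monotone function \<open>tanh (x / 2)\<close>, so the
  sum telescopes.
\<close>
lemma sum_exp_abs_le: "(\<Sum>k<n. exp (- \<bar>real k - y\<bar>)) \<le> 8"
proof -
  have step: "exp (- \<bar>x\<bar>) \<le> 4 * (tanh ((x + 1) / 2) - tanh (x / 2))" for x :: real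
  proof -
    have ca: "cosh v \<le> exp \<bar>v\<bar>" for v :: real
    proof -
      have "exp v \<le> exp \<bar>v\<bar>" "exp (- v) \<le> exp \<bar>v\<bar>" by auto
      moreover have "(a + b) / 2 \<le> e" if "a \<le> e" "b \<le> e" for a b e :: real using that by simp
      ultimately show ?thesis unfolding cosh_field_def by blast
    qed
    have "tanh ((x + 1) / 2) - tanh (x / 2) = sinh (1/2) / (cosh ((x + 1) / 2) * cosh (x / 2))"
    proof -
      have "sinh (1/2::real) = sinh ((x + 1) / 2 - x / 2)" by (simp add: diff_divide_distrib[symmetric])
      also have "\<dots> = sinh ((x + 1) / 2) * cosh (x / 2) - cosh ((x + 1) / 2) * sinh (x / 2)" by (rule sinh_diff)
      finally show ?thesis by (simp add: tanh_def field_simps)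
    qed
    moreover have "cosh ((x + 1) / 2) * cosh (x / 2) \<le> exp (1/2) * exp \<bar>x\<bar>"
    proof -
      have "cosh ((x + 1) / 2) * cosh (x / 2) \<le> exp \<bar>(x + 1) / 2\<bar> * exp \<bar>x / 2\<bar>"
        by (intro mult_mono ca) auto
      also have "\<dots> \<le> exp (1/2 + \<bar>x\<bar>)"
        unfolding exp_add[symmetric] exp_le_cancel_iff by (auto simp: abs_if field_simps)
      finally show ?thesis by (simp add: exp_add)
    qed
    moreover have "exp (1/2) \<le> (2::real)"
    proof -
      have "(exp (1/2))\<^sup>2 = exp (1::real)" by (simp flip: exp_double)
      also have "\<dots> \<le> 2\<^sup>2" using exp_le by simp
      finally show ?thesis by (rule power2_le_imp_le) simp
    qed
    moreover have "sinh (1/2) \<ge> (1/2::real)"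
    proof -
      have "1/2 \<le> (exp (1/2) - exp (- (1/2))) / (2::real)"
      proof -
        have "exp (1/2) \<ge> (13/8 :: real)"
          using exp_lower_Taylor_quadratic[of "1/2::real"] by (simp add: power2_eq_square)
        moreover from this have "exp (- (1/2)) \<le> (inverse (13/8) :: real)"
          unfolding exp_minus by (intro le_imp_inverse_le) auto
        ultimately show ?thesis by simp
      qed
      then show ?thesis by (simp add: sinh_def)
    qed
    moreover have "(1/2) / (2 * exp \<bar>x\<bar>) \<le> sinh (1/2) / (cosh ((x + 1) / 2) * cosh (x / 2))"
    proof (rule frac_le)
      have "exp (1/2) * exp \<bar>x\<bar> \<le> 2 * exp \<bar>x\<bar>" using calculation(3) by (intro mult_right_mono) auto
      then show "cosh ((x + 1) / 2) * cosh (x / 2) \<le> 2 * exp \<bar>x\<bar>" using calculation(2) by linarith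
    qed (use calculation(4) in auto)
    ultimately have "(1/2) / (2 * exp \<bar>x\<bar>) \<le> tanh ((x + 1) / 2) - tanh (x / 2)" by simp
    then show ?thesis by (simp add: exp_minus field_simps)
  qed
  have "(\<Sum>k<n. exp (- \<bar>real k - y\<bar>)) \<le> (\<Sum>k<n. 4 * (tanh ((real (Suc k) - y) / 2) - tanh ((real k - y) / 2)))"
    using step[of "real _ - y"] by (intro sum_mono) (simp add: algebra_simps)
  also have "\<dots> = 4 * (tanh ((real n - y) / 2) - tanh ((real 0 - y) / 2))"
    unfolding sum_distrib_left[symmetric] using sum_lessThan_telescope[of "\<lambda>k. tanh ((real k - y) / 2)" n] by simp
  also have "\<dots> \<le> 8" using tanh_real_lt_1[of "(real n - y) / 2"] tanh_real_gt_neg1[of "(real 0 - y) / 2"]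
    unfolding of_nat_0 by argo
  finally show ?thesis .
qed

text \<open>
  All \<open>k\<close> lie in \<open>{0..l}\<close>.  Of the lattice \<open>m + (l/2)\<int>\<close> only four points around this interval matter: every
  other one is at least as far from each \<open>k\<close> as one of these.
\<close>
lemma sum_exp_lattice_le:
  assumes l: "l > 0" and n: "real n \<le> l + 1"
  shows "(\<Sum>k<n. exp (- \<bar>real k - (m + of_int (j k) * (l / 2))\<bar>)) \<le> 32"
proof -
  define i0 where "i0 = \<lfloor>- m / (l/2)\<rfloor>"
  define p where "p i = m + of_int i * (l/2)" for i
  define I where "I = {i0 .. i0 + 3}"
  have fl: "of_int i0 \<le> - m / (l/2)" "- m / (l/2) < of_int i0 + 1" unfolding i0_def by linarith+
  have p0: "p i0 \<le> 0" "p (i0 + 3) \<ge> l" using fl l by (auto simp: p_def field_simps)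
  have nearby: "exp (- \<bar>real k - p (j k)\<bar>) \<le> (\<Sum>i\<in>I. exp (- \<bar>real k - p i\<bar>))" if "k < n" for k
  proof -
    have kl: "real k \<le> l" using that n by linarith
    have mono: "p i \<le> p i'" if "i \<le> i'" for i i' using that l by (simp add: p_def)
    obtain i where i: "i \<in> I" "\<bar>real k - p i\<bar> \<le> \<bar>real k - p (j k)\<bar>"
    proof (cases "j k < i0")
      case True
      then show ?thesis using mono[of "j k" i0] p0 by (intro that[of i0]) (auto simp: I_def)
    next
      case False
      show ?thesis
      proof (cases "j k > i0 + 3")
        case True
        then show ?thesis using mono[of "i0 + 3" "j k"] p0 kl by (intro that[of "i0 + 3"]) (auto simp: I_def)
      qed (use False in \<open>auto simp: I_def intro!: that[of "j k"]\<close>)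
    qed
    have "exp (- \<bar>real k - p (j k)\<bar>) \<le> exp (- \<bar>real k - p i\<bar>)" using i by simp
    also have "\<dots> \<le> (\<Sum>i\<in>I. exp (- \<bar>real k - p i\<bar>))" using i by (intro member_le_sum) (auto simp: I_def)
    finally show ?thesis .
  qed
  have "(\<Sum>k<n. exp (- \<bar>real k - p (j k)\<bar>)) \<le> (\<Sum>k<n. \<Sum>i\<in>I. exp (- \<bar>real k - p i\<bar>))"
    by (intro sum_mono nearby) simp
  also have "\<dots> = (\<Sum>i\<in>I. \<Sum>k<n. exp (- \<bar>real k - p i\<bar>))" by (rule sum.swap)
  also have "\<dots> \<le> (\<Sum>i\<in>I. 8)" by (intro sum_mono sum_exp_abs_le)
  also have "\<dots> = 32" by (simp add: I_def)
  finally show ?thesis unfolding p_def .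
qed

text \<open>
  Let \<open>a + l k1\<close> and \<open>a + t l + l k2\<close> be the points of the two lattices nearest to \<open>s\<close>, and let \<open>y\<close> be the position of
  \<open>s\<close> relative to their midpoint.  The two distances are \<open>|y + d|\<close> and \<open>|y - d|\<close>, where \<open>2|d|\<close> is the distance between
  the two points; their maximum is \<open>|y| + |d|\<close>, and \<open>|d| \<ge> |t| l / 2\<close> because \<open>|t| \<le> 1/2\<close>.
\<close>
lemma two_lattices_dist:
  assumes l: "l > 0" and t: "\<bar>t\<bar> \<le> 1/2"
  obtains j :: int where "\<bar>t\<bar> * (l / 2) + \<bar>s - (a + t * l / 2 + of_int j * (l / 2))\<bar> \<le> max (lattice_dist l (s - a)) (lattice_dist l (s - (a + t * l)))"
proof -
  define k1 k2 where "k1 = round ((s - a) / l)" and "k2 = round ((s - (a + t * l)) / l)"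
  define M where "M = max (lattice_dist l (s - a)) (lattice_dist l (s - (a + t * l)))"
  define y where "y = s - (a + t * l / 2 + of_int (k1 + k2) * (l / 2))"
  define d where "d = t * l / 2 - of_int (k1 - k2) * (l / 2)"
  have "y + d = s - a - l * of_int k1" "y - d = s - (a + t * l) - l * of_int k2"
    by (simp_all add: y_def d_def algebra_simps add_divide_distrib diff_divide_distrib)
  then have "\<bar>y + d\<bar> \<le> M" "\<bar>y - d\<bar> \<le> M" by (simp_all add: M_def lattice_dist_def k1_def k2_def)
  then have yd: "\<bar>y\<bar> + \<bar>d\<bar> \<le> M" by linarith
  have "\<bar>t\<bar> * (l / 2) \<le> \<bar>d\<bar>"
  proof (cases "k1 = k2")
    case False
    then have "\<bar>real_of_int (k1 - k2)\<bar> \<ge> 1" by linarith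
    then have "\<bar>t - of_int (k1 - k2)\<bar> \<ge> \<bar>t\<bar>" using t by linarith
    then have "\<bar>t\<bar> * (l/2) \<le> \<bar>t - of_int (k1 - k2)\<bar> * (l/2)" using l by (intro mult_right_mono) auto
    also have "\<dots> = \<bar>(t - of_int (k1 - k2)) * (l/2)\<bar>" using l by (simp add: abs_mult)
    also have "(t - of_int (k1 - k2)) * (l/2) = d" unfolding d_def left_diff_distrib by simp
    finally show ?thesis .
  qed (use l in \<open>simp add: d_def abs_mult\<close>)
  then show ?thesis using yd by (intro that[of "k1 + k2"]) (simp add: M_def y_def)
qed

section \<open>The glued annulus\<close>

lemma collar_width_bounds:
  assumes "l > 0" "k > 0" "k * cosh (l / 2) \<le> 1"
  shows "collar_width l k a s > 0" "collar_width l k a s \<le> 1"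
    "collar_width l k a s \<le> exp \<bar>s - s'\<bar> * collar_width l k a s'"
    "k / 2 * exp (lattice_dist l (s - a)) \<le> collar_width l k a s"
proof -
  define d d' where "d = lattice_dist l (s - a)" and "d' = lattice_dist l (s' - a)"
  show "collar_width l k a s > 0" using assms(2) by (simp add: collar_width_def)
  have "cosh d \<le> cosh (l / 2)"
    using lattice_dist_le_half[OF assms(1), of "s - a"] assms(1) by (simp add: d_def cosh_real_nonneg_le_iff)
  then have "k * cosh d \<le> k * cosh (l / 2)" using assms(2) by simp
  then show "collar_width l k a s \<le> 1" using assms(3) by (simp add: collar_width_def d_def)
  have dd: "\<bar>d - d'\<bar> \<le> \<bar>s - s'\<bar>" using lattice_dist_lipschitz[OF assms(1), of "s - a" "s' - a"] by (simp add: d_def d'_def)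
  have "exp d \<le> exp (\<bar>s - s'\<bar> + d')" "exp (- d) \<le> exp (\<bar>s - s'\<bar> + - d')"
    unfolding exp_le_cancel_iff using dd by linarith+
  then have "cosh d \<le> exp \<bar>s - s'\<bar> * cosh d'" unfolding cosh_field_def exp_add by (simp add: distrib_left)
  then have "k * cosh d \<le> k * (exp \<bar>s - s'\<bar> * cosh d')" using assms(2) by (intro mult_left_mono) auto
  then show "collar_width l k a s \<le> exp \<bar>s - s'\<bar> * collar_width l k a s'"
    by (simp add: collar_width_def d_def d'_def mult_ac)
  have "exp d / 2 \<le> cosh d" by (simp add: cosh_field_def)
  then have "k * (exp d / 2) \<le> k * cosh d" using assms(2) by (intro mult_left_mono) auto
  then show "k / 2 * exp (lattice_dist l (s - a)) \<le> collar_width l k a s"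
    by (simp add: collar_width_def d_def)
qed

lemma collar_width_periodic:
  assumes "l > 0" shows "collar_width l k a (l + s) = collar_width l k a s"
  using lattice_dist_shift[OF assms, of 1 "s - a"] by (simp add: collar_width_def add_diff_eq)

lemma quotient_width_metric:
  assumes pos: "\<And>s. F s > 0" and per: "\<And>s. F (l + s) = F s" and cont: "continuous_on UNIV F"
  shows "quotient_metric l (width_metric F)"
  unfolding quotient_metric_def
proof (intro conjI ballI)
  have "F \<in> borel_measurable borel" using cont by (rule borel_measurable_continuous_onI)
  then show "width_metric F \<in> borel_measurable borel"
    unfolding width_metric_def[abs_def] by measurable
  fix z assume "z \<in> uhp"
  then have n: "cmod z > 0" by (auto simp: uhp_def)
  have "F (ln (cmod (of_real (exp l) * z))) = F (ln (cmod z))" using n per by (simp add: norm_mult ln_mult)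
  then show "ennreal (exp l) * width_metric F (of_real (exp l) * z) = width_metric F z"
    using n pos[of "ln (cmod z)"] by (simp add: width_metric_def norm_mult flip: ennreal_mult)
qed

text \<open>
  The competing metrics must have nonzero area, so the region has to contain an open set.
\<close>
lemma metric_area_nonzero:
  assumes pos: "\<And>s. F s > 0" and cont: "continuous_on UNIV F"
    and U: "open U" "U \<noteq> {}" "U \<subseteq> R \<inter> {z. 1 < cmod z \<and> cmod z < exp l}"
  shows "metric_area l R (width_metric F) \<noteq> 0"
proof
  assume z: "metric_area l R (width_metric F) = 0"
  have "F \<in> borel_measurable borel" using cont by (rule borel_measurable_continuous_onI)
  then have m: "width_metric F \<in> borel_measurable borel" unfolding width_metric_def[abs_def] by measurable
  have mU: "U \<in> sets lborel" using U(1) by simp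
  have "(\<integral>\<^sup>+ z\<in>U. (width_metric F z)\<^sup>2 \<partial>lborel) \<le> metric_area l R (width_metric F)"
    unfolding metric_area_def using U(3) by (intro nn_integral_mono) (auto simp: indicator_def)
  then have "(\<integral>\<^sup>+ z\<in>U. (width_metric F z)\<^sup>2 \<partial>lborel) = 0" using z by simp
  moreover have "(\<lambda>z. (width_metric F z)\<^sup>2 * indicator U z) \<in> borel_measurable lborel"
    using m mU by measurable
  ultimately have "AE z in lborel. (width_metric F z)\<^sup>2 * indicator U z = 0"
    by (subst (asm) nn_integral_0_iff_AE) auto
  then have "AE z in lborel. z \<notin> U"
  proof (rule AE_mp, intro AE_I2 impI notI)
    fix z assume h: "(width_metric F z)\<^sup>2 * indicator U z = 0" and "z \<in> U"
    then have "cmod z > 0" using U(3) by force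
    then show False using h \<open>z \<in> U\<close> pos[of "ln (cmod z)"] by (simp add: width_metric_def)
  qed
  then have "emeasure lborel U = 0" using mU by (simp add: AE_iff_measurable[OF mU])
  then have "negligible U" using U(1) by (simp add: negligible_iff_emeasure0 emeasure_completion)
  then show False using open_not_negligible U by blast
qed

text \<open>
  By lemma \<open>two_lattices_dist\<close> the sum \<open>f + f'\<close> is at least \<open>q/2 exp (|t| l / 2)\<close>, and it grows exponentially with the distance
  from the lattice \<open>m + (l/2)\<int>\<close> of midpoints, so the sum of the reciprocals is at most
  a constant multiple of \<open>exp (- |t| l / 2) / q\<close>.
\<close>
lemma sum_inverse_width_le:
  fixes f f' :: "real \<Rightarrow> real"
  assumes l: "l > 0" and t: "\<bar>t\<bar> \<le> 1/2" and q: "q > 0"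
    and f: "\<And>s. f s > 0" "\<And>s. q / 2 * exp (lattice_dist l (s - a)) \<le> f s"
    and f': "\<And>s. f' s > 0" "\<And>s. q / 2 * exp (lattice_dist l (s - (a + t * l))) \<le> f' s"
  shows "(\<Sum>k<nat \<lceil>l\<rceil>. 1 / (f (real k) + f' (real k))) \<le> 64 / (q * exp (\<bar>t\<bar> * (l / 2)))"
proof -
  define m where "m = a + t * l / 2"
  have "\<exists>j :: int. \<bar>t\<bar> * (l / 2) + \<bar>real k - (m + of_int j * (l / 2))\<bar> \<le> max (lattice_dist l (real k - a)) (lattice_dist l (real k - (a + t * l)))" for k
    using two_lattices_dist[OF l t, of "real k" a] unfolding m_def by metis
  then obtain j :: "nat \<Rightarrow> int" where j: "\<And>k. \<bar>t\<bar> * (l / 2) + \<bar>real k - (m + of_int (j k) * (l / 2))\<bar> \<le> max (lattice_dist l (real k - a)) (lattice_dist l (real k - (a + t * l)))"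
    by metis
  have "1 / (f (real k) + f' (real k)) \<le> 2 / (q * exp (\<bar>t\<bar> * (l / 2))) * exp (- \<bar>real k - (m + of_int (j k) * (l / 2))\<bar>)" for k
  proof -
    define e where "e = \<bar>t\<bar> * (l / 2) + \<bar>real k - (m + of_int (j k) * (l / 2))\<bar>"
    have "q / 2 * exp e \<le> q / 2 * exp (max (lattice_dist l (real k - a)) (lattice_dist l (real k - (a + t * l))))"
      using q j[of k] unfolding e_def by (intro mult_left_mono) auto
    also have "\<dots> \<le> f (real k) + f' (real k)"
      using f[of "real k"] f'[of "real k"] by (auto simp: max_def)
    finally have "1 / (f (real k) + f' (real k)) \<le> 1 / (q / 2 * exp e)"
      using q f(1)[of "real k"] f'(1)[of "real k"] by (intro divide_left_mono mult_pos_pos add_pos_pos) auto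
    also have "\<dots> = 2 / (q * exp (\<bar>t\<bar> * (l / 2))) * exp (- \<bar>real k - (m + of_int (j k) * (l / 2))\<bar>)"
      unfolding e_def exp_add exp_minus by (simp add: field_simps)
    finally show ?thesis .
  qed
  then have "(\<Sum>k<nat \<lceil>l\<rceil>. 1 / (f (real k) + f' (real k))) \<le> (\<Sum>k<nat \<lceil>l\<rceil>. 2 / (q * exp (\<bar>t\<bar> * (l / 2))) * exp (- \<bar>real k - (m + of_int (j k) * (l / 2))\<bar>))"
    by (intro sum_mono)
  also have "\<dots> = 2 / (q * exp (\<bar>t\<bar> * (l / 2))) * (\<Sum>k<nat \<lceil>l\<rceil>. exp (- \<bar>real k - (m + of_int (j k) * (l / 2))\<bar>))"
    by (simp add: sum_distrib_left)
  also have "\<dots> \<le> 2 / (q * exp (\<bar>t\<bar> * (l / 2))) * 32"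
    using l q by (intro mult_left_mono sum_exp_lattice_le) (linarith | simp)+
  finally show ?thesis by simp
qed

text \<open>
  The sign \<open>\<sigma>\<close> selects the side of the imaginary axis, so that both halves of the glued annulus are
  described by a positive \<open>k = tanh \<ell>(\<eta>)\<close>.
\<close>
lemma half_collar_in_log_coordinates:
  assumes hc: "half_collar l X" and l: "l > 0" and sg: "\<sigma> = 1 \<or> \<sigma> = -1" and side: "\<And>z. z \<in> cover X \<Longrightarrow> \<sigma> * Re z \<ge> 0"
  obtains k where "k > 0" "k * cosh (l / 2) \<le> 1" "Im (foot1 X) > 0"
    "beta_lift l X \<subseteq> {z \<in> uhp. Re z = \<sigma> * cmod z * collar_width l k (ln (Im (foot1 X)) + l / 2) (ln (cmod z))}"
    "half_collar_lift l X \<subseteq> {z \<in> uhp. \<bar>Re z\<bar> \<le> cmod z * collar_width l k (ln (Im (foot1 X)) + l / 2) (ln (cmod z))}"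
    "\<exists>U. open U \<and> U \<noteq> {} \<and> U \<subseteq> half_collar_lift l X \<inter> {z. 1 < cmod z \<and> cmod z < exp l}"
    "exp (r_fun (eta_length X)) \<ge> 1 / k"
proof -
  obtain k r1 r2 where r: "r1 > 0" "foot1 X = of_real r1 * \<i>" "foot2 X = of_real r2 * \<i>"
    "ln r2 = ln r1 + l / 2" "r2 > 0" and k: "k \<noteq> 0" "\<bar>k\<bar> * cosh (l / 2) \<le> 1"
    and c: "cross X \<in> uhp" "cmod (cross X) = r2" "Re (cross X) = r2 * k"
    and lp: "loop X = {p \<in> perp_arc r2 k. \<bar>ln (cmod p) - ln r2\<bar> \<le> l / 2}"
    by (rule loop_eq_perp_arc_part[OF hc l])
  have beta: "beta_lift l X = {p \<in> uhp. Re p = cmod p * collar_width l k (ln r2) (ln (cmod p))}"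
    using beta_lift_eq_periodic_graph[OF l lp] by (simp add: collar_width_def)
  have "cross X \<in> cover X" using hc by (simp add: half_collar_def)
  then have "r2 * (\<sigma> * k) \<ge> 0" using side[of "cross X"] c(3) by (simp add: mult.left_commute)
  then have "\<sigma> * k \<ge> 0" using r(5) by (auto simp: zero_le_mult_iff)
  then have ks: "k = \<sigma> * \<bar>k\<bar>" using sg by auto
  have cr: "Re (cross X) * k > 0" using c(3) r(5) k(1) by (simp add: mult.assoc flip: power2_eq_square)
  have side': "k * Re z \<ge> 0" if "z \<in> cover X" for z
    using mult_nonneg_nonneg[OF abs_ge_zero[of k] side[OF that]] ks by (metis mult.assoc mult.commute)
  have f1: "foot1 X \<in> imag_axis" using hc by (simp add: half_collar_def)
  note d = half_collar_lift_shape[OF l hc f1 k(1) beta c(1) cr side']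
  have a: "ln r2 = ln (Im (foot1 X)) + l / 2" using r by simp
  have cw: "collar_width l k (ln r2) s = \<sigma> * collar_width l \<bar>k\<bar> (ln r2) s" for s
    unfolding collar_width_def by (subst ks) simp
  show ?thesis
  proof (rule that[of "\<bar>k\<bar>"])
    show "beta_lift l X \<subseteq> {z \<in> uhp. Re z = \<sigma> * cmod z * collar_width l \<bar>k\<bar> (ln (Im (foot1 X)) + l / 2) (ln (cmod z))}"
      unfolding beta cw a[symmetric] by auto
    show "exp (r_fun (eta_length X)) \<ge> 1 / \<bar>k\<bar>"
      unfolding eta_length_def r(3) by (rule exp_r_fun_ge[OF c r(5) k(1)])
  qed (use k r d a in auto)
qed

lemma extremal_length_ge:
  assumes "quotient_metric l \<rho>" "metric_area l R \<rho> \<noteq> 0" "metric_area l R \<rho> \<le> ennreal A" "A > 0" "d \<ge> 0"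
    and "\<And>c. c \<in> connecting_curves R E F \<Longrightarrow> ennreal d \<le> metric_length \<rho> c"
  shows "ennreal (d\<^sup>2 / A) \<le> annulus_extremal_length l R E F"
proof -
  obtain m where m: "metric_area l R \<rho> = ennreal m" "0 < m" "m \<le> A"
    using assms by (cases "metric_area l R \<rho>") (auto simp: top_unique)
  have "ennreal (d\<^sup>2 / A) \<le> ennreal (d\<^sup>2 / m)"
    using m by (intro ennreal_leI divide_left_mono) auto
  also have "\<dots> = (ennreal d)\<^sup>2 / metric_area l R \<rho>" using m assms by (simp add: divide_ennreal ennreal_power)
  also have "\<dots> \<le> (INF c\<in>connecting_curves R E F. metric_length \<rho> c)\<^sup>2 / metric_area l R \<rho>"
    using assms by (intro divide_right_mono_ennreal power_mono INF_greatest) auto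
  also have "\<dots> \<le> annulus_extremal_length l R E F"
    unfolding annulus_extremal_length_def
  proof (rule SUP_upper)
    have "metric_area l R \<rho> < \<infinity>" using assms(3) by (simp add: order_le_less_trans[OF _ ennreal_less_top])
    then show "\<rho> \<in> {\<rho>. quotient_metric l \<rho> \<and> metric_area l R \<rho> \<noteq> 0 \<and> metric_area l R \<rho> \<noteq> \<infinity>}" using assms by auto
  qed
  finally show ?thesis .
qed

text \<open>
  The constant is \<open>(1/8)\<^sup>2 / (2 exp 5 \<cdot> 64)\<close>: the square of the length bound over the area bound, where \<open>2 exp 5\<close>
  comes from the area of a single piece and \<open>64\<close> comes from the sum over the pieces.
\<close>
lemma glued_extremal_length_ge:
  assumes gl: "glued l t X X'" and l: "l > 0" and t: "\<bar>t\<bar> \<le> 1/2"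
  shows "annulus_extremal_length l (glued_lift l X X') (beta_lift l X) (beta_lift l X')
    \<ge> ennreal (1 / (8192 * exp 5) / max (exp (r_fun (eta_length X) - \<bar>t\<bar> * (l / 2))) (exp (r_fun (eta_length X') - \<bar>t\<bar> * (l / 2))))"
proof -
  have hc: "half_collar l X" "half_collar l X'" and ft: "Im (foot1 X') = exp (t * l) * Im (foot1 X)"
    and side: "\<And>z. z \<in> cover X \<Longrightarrow> 1 * Re z \<ge> 0" "\<And>z. z \<in> cover X' \<Longrightarrow> (-1) * Re z \<ge> 0"
    using gl by (auto simp: glued_def)
  define a where "a = ln (Im (foot1 X)) + l / 2"
  obtain k where k: "k > 0" "k * cosh (l / 2) \<le> 1" and f1: "Im (foot1 X) > 0"
    and b: "beta_lift l X \<subseteq> {z \<in> uhp. Re z = 1 * cmod z * collar_width l k a (ln (cmod z))}"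
    and h: "half_collar_lift l X \<subseteq> {z \<in> uhp. \<bar>Re z\<bar> \<le> cmod z * collar_width l k a (ln (cmod z))}"
    and U: "\<exists>U. open U \<and> U \<noteq> {} \<and> U \<subseteq> half_collar_lift l X \<inter> {z. 1 < cmod z \<and> cmod z < exp l}"
    and e: "exp (r_fun (eta_length X)) \<ge> 1 / k"
    unfolding a_def by (rule half_collar_in_log_coordinates[OF hc(1) l _ side(1)]) auto
  define a' where "a' = ln (Im (foot1 X')) + l / 2"
  obtain k' where k': "k' > 0" "k' * cosh (l / 2) \<le> 1"
    and b': "beta_lift l X' \<subseteq> {z \<in> uhp. Re z = - 1 * cmod z * collar_width l k' a' (ln (cmod z))}"
    and h': "half_collar_lift l X' \<subseteq> {z \<in> uhp. \<bar>Re z\<bar> \<le> cmod z * collar_width l k' a' (ln (cmod z))}"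
    and e': "exp (r_fun (eta_length X')) \<ge> 1 / k'"
    unfolding a'_def by (rule half_collar_in_log_coordinates[OF hc(2) l _ side(2)]) auto
  have a': "a' = a + t * l" using f1 by (simp add: a'_def a_def ft ln_mult)
  define f f' where "f = collar_width l k a" and "f' = collar_width l k' a'"
  define F where "F s = f s + f' s" for s
  note w = collar_width_bounds[OF l k, where a = a, folded f_def] and w' = collar_width_bounds[OF l k', where a = a', folded f'_def]
  have Fpos: "F s > 0" for s using w(1)[of s] w'(1)[of s] by (simp add: F_def)
  have Flip: "F s \<le> exp \<bar>s - s'\<bar> * F s'" for s s' using w(3)[of s s'] w'(3)[of s s'] by (simp add: F_def distrib_left)
  have Fcont: "continuous_on UNIV F"
    unfolding F_def f_def f'_def using l by (intro continuous_intros continuous_collar_width)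
  have Fper: "F (l + s) = F s" for s using collar_width_periodic[OF l] by (simp add: F_def f_def f'_def)
  define R where "R = glued_lift l X X'"
  have R: "R \<subseteq> {z \<in> uhp. \<bar>Re z\<bar> \<le> cmod z * F (ln (cmod z))}"
  proof
    fix z assume "z \<in> R"
    then have "z \<in> uhp" "\<bar>Re z\<bar> \<le> cmod z * f (ln (cmod z)) \<or> \<bar>Re z\<bar> \<le> cmod z * f' (ln (cmod z))"
      using h h' by (auto simp: R_def glued_lift_def f_def f'_def)
    moreover have "cmod z * f (ln (cmod z)) \<le> cmod z * F (ln (cmod z))" "cmod z * f' (ln (cmod z)) \<le> cmod z * F (ln (cmod z))"
      using w(1)[of "ln (cmod z)"] w'(1)[of "ln (cmod z)"] by (intro mult_left_mono; simp add: F_def)+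
    ultimately show "z \<in> {z \<in> uhp. \<bar>Re z\<bar> \<le> cmod z * F (ln (cmod z))}" by auto
  qed
  define q where "q = min k k'"
  have q: "q > 0" using k k' by (simp add: q_def)
  define A where "A = 128 * exp 5 / (q * exp (\<bar>t\<bar> * (l / 2)))"
  have area: "metric_area l R (width_metric F) \<le> ennreal A"
  proof -
    have "(\<Sum>k<nat \<lceil>l\<rceil>. 1 / F (real k)) \<le> 64 / (q * exp (\<bar>t\<bar> * (l / 2)))"
      unfolding F_def
    proof (rule sum_inverse_width_le[OF l t q w(1) _ w'(1)])
      have "q / 2 * exp d \<le> k / 2 * exp d" "q / 2 * exp d \<le> k' / 2 * exp d" for d
        by (intro mult_right_mono; simp add: q_def)+
      then show "q / 2 * exp (lattice_dist l (s - a)) \<le> f s"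
        and "q / 2 * exp (lattice_dist l (s - (a + t * l))) \<le> f' s" for s
        using w(4)[of s] w'(4)[of s] unfolding a' by (meson order_trans)+
    qed
    then have "2 * exp 5 * (\<Sum>k<nat \<lceil>l\<rceil>. 1 / F (real k)) \<le> 2 * exp 5 * (64 / (q * exp (\<bar>t\<bar> * (l / 2))))"
      by (intro mult_left_mono) auto
    then have "(\<Sum>k<nat \<lceil>l\<rceil>. 2 * exp 5 / F (real k)) \<le> A"
      by (simp add: A_def sum_distrib_left)
    then show ?thesis
      using order_trans[OF width_metric_area_le[of F R l, OF Fpos Flip R] ennreal_leI] by blast
  qed
  have nz: "metric_area l R (width_metric F) \<noteq> 0"
  proof -
    obtain U where "open U" "U \<noteq> {}" "U \<subseteq> half_collar_lift l X \<inter> {z. 1 < cmod z \<and> cmod z < exp l}" using U by blast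
    then show ?thesis by (intro metric_area_nonzero[OF Fpos Fcont, of U]) (auto simp: R_def glued_lift_def)
  qed
  have len: "ennreal (1/8) \<le> metric_length (width_metric F) c"
    if c: "c \<in> connecting_curves R (beta_lift l X) (beta_lift l X')" for c
    unfolding F_def[abs_def]
  proof (rule width_metric_length_ge[OF w(1) w'(1) _ w(3) w'(3)])
    show "f s + f' s \<le> 2" for s using w(2)[of s] w'(2)[of s] by simp
    show "c piecewise_C1_differentiable_on {0..1}" using c by (simp add: connecting_curves_def)
    have c0: "c 0 \<in> uhp" "Re (c 0) = cmod (c 0) * f (ln (cmod (c 0)))" using c b by (auto simp: connecting_curves_def f_def)
    have c1: "c 1 \<in> uhp" "Re (c 1) = - (cmod (c 1) * f' (ln (cmod (c 1))))" using c b' by (auto simp: connecting_curves_def f'_def)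
    show "c t \<in> uhp" if "t \<in> {0..1}" for t
    proof (cases "t = 0 \<or> t = 1")
      case False
      then have "t \<in> {0<..<1}" using that by auto
      then have "c t \<in> R" using c by (auto simp: connecting_curves_def)
      then show ?thesis using R by blast
    qed (use c0 c1 in auto)
    have "cmod (c 0) > 0" "cmod (c 1) > 0" using c0(1) c1(1) by (auto simp: uhp_def)
    then have "Re (c 0) / cmod (c 0) = f (ln (cmod (c 0)))" "Re (c 1) / cmod (c 1) = - f' (ln (cmod (c 1)))"
      using c0(2) c1(2) by (simp_all add: field_simps)
    then show "f (ln (cmod (c 0))) + f' (ln (cmod (c 1))) \<le> \<bar>Re (c 0) / cmod (c 0) - Re (c 1) / cmod (c 1)\<bar>" by simp
  qed
  have Apos: "A > 0" using q by (simp add: A_def)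
  have "ennreal ((1/8)\<^sup>2 / A) \<le> annulus_extremal_length l R (beta_lift l X) (beta_lift l X')"
    by (rule extremal_length_ge[OF quotient_width_metric[OF Fpos Fper Fcont] nz area Apos _ len]) auto
  moreover define m where "m = max (exp (r_fun (eta_length X) - \<bar>t\<bar> * (l / 2))) (exp (r_fun (eta_length X') - \<bar>t\<bar> * (l / 2)))"
  have "1 / (8192 * exp 5) / m \<le> (1/8)\<^sup>2 / A"
  proof -
    have "1 / k / exp (\<bar>t\<bar> * (l / 2)) \<le> m" "1 / k' / exp (\<bar>t\<bar> * (l / 2)) \<le> m"
      unfolding m_def exp_diff using e e' by (intro max.coboundedI1 max.coboundedI2 divide_right_mono; simp)+
    then have "1 / q / exp (\<bar>t\<bar> * (l / 2)) \<le> m" by (simp add: q_def min_def)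
    then have "1 / (8192 * exp 5) / m \<le> 1 / (8192 * exp 5) / (1 / q / exp (\<bar>t\<bar> * (l / 2)))"
      using q by (intro divide_left_mono mult_pos_pos) (auto simp: m_def less_max_iff_disj)
    also have "\<dots> = (1/8)\<^sup>2 / A" using q by (simp add: A_def power2_eq_square field_simps)
    finally show ?thesis .
  qed
  ultimately show ?thesis unfolding R_def m_def[symmetric]
    using order_trans[OF ennreal_leI] by blast
qed

theorem theorem6p1:
  fixes l0 :: real
  assumes "l0 \<ge> 2"
  shows "\<exists>C>0. \<forall>(X :: half_collar_data) (X' :: half_collar_data) (l :: real) (t :: real).
           glued l t X X' \<and> l \<ge> l0 \<and> - (1/2) \<le> t \<and> t < 1/2 \<longrightarrow>
           annulus_extremal_length l (glued_lift l X X') (beta_lift l X) (beta_lift l X')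
             \<ge> ennreal (C / max (exp (r_fun (eta_length X) - \<bar>t\<bar> * (l / 2)))
                                (exp (r_fun (eta_length X') - \<bar>t\<bar> * (l / 2))))"
proof (intro exI[of _ "1 / (8192 * exp 5)"] conjI allI impI)
  fix X X' :: half_collar_data and l t :: real
  assume "glued l t X X' \<and> l \<ge> l0 \<and> - (1/2) \<le> t \<and> t < 1/2"
  then show "annulus_extremal_length l (glued_lift l X X') (beta_lift l X) (beta_lift l X')
      \<ge> ennreal (1 / (8192 * exp 5) / max (exp (r_fun (eta_length X) - \<bar>t\<bar> * (l / 2)))
                                          (exp (r_fun (eta_length X') - \<bar>t\<bar> * (l / 2))))"
    using assms by (intro glued_extremal_length_ge) auto
qed simp

end
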